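(* Let $n$ be a positive integer. For $m\in\{0,1,2\}$, we have $$C_m(n)=\sum_{j=-\infty}^{\infty}(-1)^j\,u_m\big(n-j(3j-1)/2\big).$$
   Context: Unimodal compositions. A composition of a positive integer $n$ is a sequence $(\lambda_1,\ldots,\lambda_r)$ of positive integers (parts) with sum $n$. It is unimodal if there exists $t\in\{1,\ldots,r\}$ with $\lambda_1\leqslant\cdots\leqslant\lambda_t$ and $\lambda_t\geqslant\cdots\geqslant\lambda_r$. For $n\geqslant 1$, $u_0(n)$ is the number of unimodal compositions of $n$, and $u_0(0)=0$. For $m\geqslant1$ and $n\geqslant0$, $u_m(n)$ is the number of unimodal compositions of $n+m$ in which the maximal part appears exactly $m$ times; in particular $u_m(0)=1$. Convention: $u_m(n)=0$ for $n<0$ (so the sum over $j\in\mathbb{Z}$ has finitely many nonzero terms). Crank. For a partition $\lambda=(\lambda_1\geqslant\lambda_2\geqslant\cdots)$, let $\omega(\lambda)$ be the number of parts of $\lambda$ equal to $1$, and $\mu(\lambda)$ the number of parts of $\lambda$ larger than $\omega(\lambda)$. The crank is $c(\lambda)=\lambda_1$ (the largest part) if $\omega(\lambda)=0$, and $c(\lambda)=\mu(\lambda)-\omega(\lambda)$ if $\omega(\lambda)>0$. For an integer $n\geqslant 2$: $C_0(n)$ is the number of partitions $\lambda$ of $n$ with $c(\lambda)>0$; $C_1(n)$ is the number of partitions $\lambda$ of $n$ with $c(\lambda)\geqslant0$; $C_2(n)$ is the number of partitions $\lambda$ of $n$ with $c(\lambda)=0$. Moreover, by definition, $C_0(1)=1$,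 $C_1(1)=0$, $C_2(1)=-1$. *)

theory Defs
  imports "HOL-Library.Multiset" "HOL-Library.Groups_Big_Fun"
begin

definition compositions :: "nat \<Rightarrow> nat list set" where
  "compositions n = {xs. (\<forall>x\<in>set xs. 0 < x) \<and> sum_list xs = n}"

text \<open>The peak index is 0-based. It is required to exist, so the empty list is not unimodal.\<close>
definition unimodal :: "nat list \<Rightarrow> bool" where
  "unimodal xs \<longleftrightarrow>
     (\<exists>t<length xs. sorted_wrt (\<le>) (take (Suc t) xs) \<and> sorted_wrt (\<ge>) (drop t xs))"

definition unimodal_compositions :: "nat \<Rightarrow> nat list set" where
  "unimodal_compositions n = {xs \<in> compositions n. unimodal xs}"

text \<open>The number $u_m(n)$, extended by zero to negative \<open>n\<close>. For positive \<open>m\<close> the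
  compositions counted are those of \<open>n + m\<close>, not of \<open>n\<close>.\<close>
definition unimodal_count :: "nat \<Rightarrow> int \<Rightarrow> nat" where
  "unimodal_count m n =
     (if n < 0 then 0
      else if m = 0 then (if n = 0 then 0 else card (unimodal_compositions (nat n)))
      else card {xs \<in> unimodal_compositions (nat n + m). count_list xs (Max (set xs)) = m})"

definition int_partitions :: "nat \<Rightarrow> nat multiset set" where
  "int_partitions n = {p. 0 \<notin># p \<and> sum_mset p = n}"

definition crank :: "nat multiset \<Rightarrow> int" where
  "crank p =
     (let w = count p 1
      in if w = 0 then int (Max_mset p)
         else int (size (filter_mset (\<lambda>x. w < x) p)) - int w)"

text \<open>The number $C_m(n)$, for $m \in \{0,1,2\}$ and positive \<open>n\<close>; the values at \<open>n = 1\<close>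
  are set by convention, not by counting. Arguments outside this range
  carry no meaning.\<close>
definition crank_count :: "nat \<Rightarrow> nat \<Rightarrow> int" where
  "crank_count m n =
     (if n = 1 then (if m = 0 then 1 else if m = 1 then 0 else - 1)
      else if m = 0 then int (card {p \<in> int_partitions n. 0 < crank p})
      else if m = 1 then int (card {p \<in> int_partitions n. 0 \<le> crank p})
      else int (card {p \<in> int_partitions n. crank p = 0}))"

text \<open>\<^const>\<open>Sum_any\<close> is zero by default on functions with infinite support; the next
  lemma shows that this does not happen for the sum over all integers considered here.\<close>
lemma finite_support_pentagonal_sum:
  "finite {j::int. (- 1) ^ nat \<bar>j\<bar> * int (unimodal_count m (int n - j * (3 * j - 1) div 2)) \<noteq> 0}"
proof (rule finite_subset)
  show "{j::int. (- 1) ^ nat \<bar>j\<bar> * int (unimodal_count m (int n - j * (3 * j - 1) div 2)) \<noteq> 0}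
        \<subseteq> {- int n..int n}"
  proof
    fix j :: int
    assume "j \<in> {j. (- 1) ^ nat \<bar>j\<bar> * int (unimodal_count m (int n - j * (3 * j - 1) div 2)) \<noteq> 0}"
    then have "j * (3 * j - 1) div 2 \<le> int n"
      by (auto simp: unimodal_count_def split: if_splits)
    moreover have "\<bar>j\<bar> \<le> j * (3 * j - 1) div 2"
    proof -
      have "2 * \<bar>j\<bar> \<le> j * (3 * j - 1)"
      proof (cases "j \<le> 0")
        case True
        then have "j * (3 * j - 1) - 2 * \<bar>j\<bar> = j * (3 * j + 1)"
          by (simp add: algebra_simps)
        moreover have "0 \<le> j * (3 * j + 1)"
          using True by (cases "j = 0") (auto intro: mult_nonpos_nonpos)
        ultimately show ?thesis by linarith
      next
        case False
        then have "2 * \<bar>j\<bar> = j * 2" by simp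
        also have "\<dots> \<le> j * (3 * j - 1)"
          using False by (intro mult_left_mono) auto
        finally show ?thesis .
      qed
      then show ?thesis by linarith
    qed
    ultimately show "j \<in> {- int n..int n}" by auto
  qed
qed simp

end

theory Submission
  imports Defs "HOL-Analysis.FPS_Convergence"
begin

text \<open>
  Write $(q)_k = (1-q)\cdots(1-q^k)$. Decomposing a unimodal composition around its maximal
  part gives the generating functions $U_m = \sum_k q^{mk}/(q)_k^2$ for $m \geq 1$ and
  $U_0 = U_1 - U_2$; moreover $2 U_1 - U_2$ telescopes to $1/(q)_\infty^2$. The partitions with
  $w > 0$ ones and $j$ parts larger than $w$ have generating function
  $(1-q)\,q^{(w+1)(j+1)-1}/((q)_w (q)_j)$. This is symmetric in $w$ and $j$, so $C_0 + C_1$ counts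
  all partitions; and $C_1 - C_0 = C_2$ has, also at $n = 1$, the coefficients of
  $(1-q)\sum_w q^{w^2+2w}/(q)_w^2$. A Durfee-rectangle identity turns the latter into
  $(q)_\infty U_2$. All three claims follow, since the pentagonal series is $(q)_\infty$, which is
  obtained here from Shanks' finite form of Euler's theorem.
\<close>

text \<open>No infinite product is formed: 1/(q)_inf is represented by its Euler expansion. Its
  inverse enters only through finite products and factors that are 1 modulo q^(n+1), which suffices
  because each claim concerns a single coefficient n. The closed form for w ones and j larger parts
  fails at w = 0, where the crank also follows another rule. The symmetry in w and j therefore
  leaves out the edges w = 0 and j = 0. These are compared separately, and their series differ by 1
  - q. Hence the balance of positive and negative cranks starts at n = 2, while at n = 1 the
  conventional values are exactly those that fit. The identities determine U_1 and U_0 through their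
  doubles, so the corresponding pentagonal sums are evaluated doubled.\<close>

unbundle no vec_syntax and fps_syntax

section \<open>Locally finite sums and generating functions\<close>

definition locfin :: "(nat \<Rightarrow> 'a::comm_ring_1 fps) \<Rightarrow> bool" where
  "locfin f \<longleftrightarrow> (\<forall>k n. n < k \<longrightarrow> f k $ n = 0)"

text \<open>The infinite sum of the series \<open>f k\<close>, meaningful only if \<^term>\<open>locfin f\<close>.\<close>
definition fsum :: "(nat \<Rightarrow> 'a::comm_ring_1 fps) \<Rightarrow> 'a fps" where
  "fsum f = Abs_fps (\<lambda>n. \<Sum>k\<le>n. f k $ n)"

text \<open>Local finiteness says that \<open>f k\<close> has order at least \<open>k\<close>, so
  later terms are invisible in degree \<open>n\<close>. The free bound \<open>N\<close> lets several
  coefficients share one truncation and allows index shifts.\<close>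

lemma fsum_nth_ge:
  assumes "locfin f" "n \<le> N"
  shows "fsum f $ n = (\<Sum>k\<le>N. f k $ n)"
proof -
  have "(\<Sum>k\<le>n. f k $ n) = (\<Sum>k\<le>N. f k $ n)"
    using assms by (intro sum.mono_neutral_left) (auto simp: locfin_def)
  then show ?thesis by (simp add: fsum_def)
qed

lemma fsum_diff: "fsum (\<lambda>k. f k - g k) = fsum f - fsum g"
  by (rule fps_ext) (simp add: fsum_def sum_subtractf)

lemma locfin_X_power_mult:
  assumes "\<And>k. k \<le> e k"
  shows "locfin (\<lambda>k. fps_X ^ e k * g k)"
  unfolding locfin_def using assms by (auto simp: fps_X_power_mult_nth dest: order_less_le_trans)

lemma fsum_mult_fsum:
  assumes f: "locfin f" and g: "locfin g"
  shows "fsum f * fsum g = fsum (\<lambda>k. \<Sum>i\<le>k. f i * g (k - i))"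
proof (rule fps_ext)
  fix n
  \<comment> \<open>Orders add: in every splitting of degree \<open>n\<close>, one factor lies below
    its order.\<close>
  have z: "(f i * g j) $ n = 0" if "n < i + j" for i j
    unfolding fps_mult_nth
  proof (intro sum.neutral ballI)
    fix l assume "l \<in> {0..n}"
    then have "l < i \<or> n - l < j" using that by auto
    then show "f i $ l * g j $ (n - l) = 0" using f g by (auto simp: locfin_def)
  qed
  have "(fsum f * fsum g) $ n = (\<Sum>l=0..n. (\<Sum>i\<le>n. f i $ l) * (\<Sum>j\<le>n. g j $ (n - l)))"
    by (simp add: fps_mult_nth fsum_nth_ge[OF f, of _ n] fsum_nth_ge[OF g, of _ n])
  also have "\<dots> = ((\<Sum>i\<le>n. f i) * (\<Sum>j\<le>n. g j)) $ n"
    by (simp add: fps_mult_nth fps_sum_nth)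
  also have "\<dots> = (\<Sum>(i,j)\<in>{..n} \<times> {..n}. (f i * g j) $ n)"
    by (simp add: sum_product fps_sum_nth sum.cartesian_product[symmetric])
  also have "\<dots> = (\<Sum>(i,j)\<in>{(i,j). i + j \<le> n}. (f i * g j) $ n)"
    by (intro sum.mono_neutral_right) (auto, metis z not_le)
  also have "\<dots> = (\<Sum>k\<le>n. \<Sum>i\<le>k. (f i * g (k - i)) $ n)"
    by (rule sum.triangle_reindex_eq)
  finally show "(fsum f * fsum g) $ n = fsum (\<lambda>k. \<Sum>i\<le>k. f i * g (k - i)) $ n"
    by (simp add: fsum_def fps_sum_nth)
qed

lemma fsum_mult_left:
  assumes f: "locfin f"
  shows "c * fsum f = fsum (\<lambda>k. c * f k)"
proof (rule fps_ext)
  fix n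
  have "(c * fsum f) $ n = (c * (\<Sum>i\<le>n. f i)) $ n"
    by (simp add: fps_mult_nth fsum_nth_ge[OF f, of _ n] fps_sum_nth)
  then show "(c * fsum f) $ n = fsum (\<lambda>k. c * f k) $ n"
    by (simp add: fsum_def sum_distrib_left fps_sum_nth)
qed

text \<open>The factor \<open>b\<close> is 1 modulo q^(n+1). This replaces passages to the limit;
  \<open>euler_sum (Suc n)\<close> and \<open>shanks_sum n\<close> are such factors.\<close>

lemma fps_mult_nth_one_upto:
  assumes "\<And>i. i \<le> n \<Longrightarrow> b $ i = (if i = 0 then 1 else 0)"
  shows "(a * b) $ n = (a $ n :: 'a::comm_ring_1)"
proof -
  have "(a * b) $ n = (\<Sum>i=0..n. if i = n then a $ n else 0)"
    unfolding fps_mult_nth by (intro sum.cong refl) (auto simp: assms)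
  then show ?thesis by simp
qed

text \<open>An infinite fibre of \<open>w\<close> contributes the junk coefficient \<open>0\<close>; \<open>finfib\<close> excludes this.\<close>
definition gf :: "'a set \<Rightarrow> ('a \<Rightarrow> nat) \<Rightarrow> int fps" where
  "gf S w = Abs_fps (\<lambda>n. int (card {x \<in> S. w x = n}))"

definition finfib :: "'a set \<Rightarrow> ('a \<Rightarrow> nat) \<Rightarrow> bool" where
  "finfib S w \<longleftrightarrow> (\<forall>n. finite {x \<in> S. w x = n})"

lemma finfib_subset: "finfib T w \<Longrightarrow> S \<subseteq> T \<Longrightarrow> finfib S w"
  unfolding finfib_def by (auto elim!: finite_subset[rotated])

lemma gf_nth: "gf S w $ n = int (card {x \<in> S. w x = n})"
  by (simp add: gf_def)

lemma gf_reindex: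
  assumes "bij_betw f S T" "\<And>x. x \<in> S \<Longrightarrow> v (f x) = w x + c"
  shows "gf T v = fps_X ^ c * gf S w"
proof (rule fps_ext)
  fix n
  show "gf T v $ n = (fps_X ^ c * gf S w) $ n"
  proof (cases "n < c")
    case True
    then have "{x \<in> T. v x = n} = {}" using assms by (auto simp: bij_betw_def)
    then show ?thesis using True by (simp add: gf_nth fps_X_power_mult_nth del: Collect_empty_eq)
  next
    case False
    then have "bij_betw f {x \<in> S. w x = n - c} {x \<in> T. v x = n}"
      using assms unfolding bij_betw_def inj_on_def by auto
    from bij_betw_same_card[OF this] show ?thesis
      using False by (simp add: gf_nth fps_X_power_mult_nth)
  qed
qed

lemma gf_Un:
  assumes "finfib (S \<union> T) w" "S \<inter> T = {}"
  shows "gf (S \<union> T) w = gf S w + gf T w"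
proof (rule fps_ext)
  fix n
  have "{x \<in> S \<union> T. w x = n} = {x \<in> S. w x = n} \<union> {x \<in> T. w x = n}" by auto
  moreover have "finite {x \<in> S. w x = n}" "finite {x \<in> T. w x = n}"
    using assms(1) finfib_subset[OF assms(1)] unfolding finfib_def by blast+
  ultimately show "gf (S \<union> T) w $ n = (gf S w + gf T w) $ n"
    using assms(2) by (simp add: gf_nth card_Un_disjoint disjoint_iff)
qed

lemma gf_Times:
  assumes S: "finfib S w" and T: "finfib T v"
  shows "gf (S \<times> T) (\<lambda>(x, y). w x + v y) = gf S w * gf T v"
proof (rule fps_ext)
  fix n
  have "{p \<in> S \<times> T. (case p of (x, y) \<Rightarrow> w x + v y) = n} =
        (\<Union>i\<in>{0..n}. {x \<in> S. w x = i} \<times> {y \<in> T. v y = n - i})" by auto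
  moreover have "card \<dots> = (\<Sum>i=0..n. card ({x \<in> S. w x = i} \<times> {y \<in> T. v y = n - i}))"
    using S T by (intro card_UN_disjoint) (auto simp: finfib_def)
  ultimately show "gf (S \<times> T) (\<lambda>(x, y). w x + v y) $ n = (gf S w * gf T v) $ n"
    by (simp only: gf_nth fps_mult_nth card_cartesian_product of_nat_sum of_nat_mult)
qed

text \<open>The bound on \<open>h\<close> keeps the class of value \<open>k\<close> out of the
  degrees below \<open>k\<close>, so the truncation built into \<open>fsum\<close> loses
  nothing.\<close>

lemma gf_fsum:
  assumes "finfib S w" "\<And>x. x \<in> S \<Longrightarrow> h x \<le> w x"
  shows "gf S w = fsum (\<lambda>k. gf {x \<in> S. h x = k} w)"
proof (rule fps_ext)
  fix n
  have "{x \<in> S. w x = n} = (\<Union>k\<in>{..n}. {x \<in> {x \<in> S. h x = k}. w x = n})"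
    using assms(2) by auto
  moreover have "card \<dots> = (\<Sum>k\<le>n. card {x \<in> {x \<in> S. h x = k}. w x = n})"
    using finfib_subset[OF assms(1), of "{x \<in> S. h x = k}" for k]
    by (intro card_UN_disjoint) (auto simp: finfib_def)
  ultimately show "gf S w $ n = fsum (\<lambda>k. gf {x \<in> S. h x = k} w) $ n"
    by (simp add: gf_nth fsum_def)
qed

section \<open>Multisets with bounded parts or bounded size\<close>

definition msets :: "'a set \<Rightarrow> 'a multiset set" where
  "msets A = {p. set_mset p \<subseteq> A}"

definition msets_size :: "nat \<Rightarrow> 'a multiset set" where
  "msets_size k = {p. size p = k}"

lemma size_le_sum_mset: "0 \<notin># p \<Longrightarrow> size p \<le> sum_mset (p :: nat multiset)"
  by (induction p) auto

lemma mem_le_sum_mset: "x \<in># p \<Longrightarrow> x \<le> sum_mset (p :: nat multiset)"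
  by (induction p) auto

text \<open>Zeros do not change the sum; the bound on the size limits their number.\<close>

lemma finite_mset_bounded: "finite {p :: nat multiset. sum_mset p = n \<and> size p \<le> k}"
proof (rule finite_subset)
  show "{p. sum_mset p = n \<and> size p \<le> k} \<subseteq> mset ` {xs. set xs \<subseteq> {..n} \<and> length xs \<le> k}"
  proof
    fix p :: "nat multiset" assume p: "p \<in> {p. sum_mset p = n \<and> size p \<le> k}"
    obtain xs where "mset xs = p" using ex_mset by blast
    with p show "p \<in> mset ` {xs. set xs \<subseteq> {..n} \<and> length xs \<le> k}"
      using mem_le_sum_mset by (intro image_eqI[of _ _ xs]) auto
  qed
  show "finite (mset ` {xs. set xs \<subseteq> {..n} \<and> length xs \<le> k})"
    using finite_lists_length_le[of "{..n}" k] by simp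
qed

lemma finfib_pos: "finfib {p. 0 \<notin># p} (sum_mset :: nat multiset \<Rightarrow> nat)"
  unfolding finfib_def
proof
  fix n
  show "finite {p \<in> {p. 0 \<notin># p}. sum_mset p = (n::nat)}"
    by (rule finite_subset[OF _ finite_mset_bounded[of n n]]) (auto dest: size_le_sum_mset)
qed

lemma finfib_msets: "0 \<notin> A \<Longrightarrow> finfib (msets A) (sum_mset :: nat multiset \<Rightarrow> nat)"
  by (rule finfib_subset[OF finfib_pos]) (auto simp: msets_def)

lemma finfib_msets_size: "finfib (msets_size k) (sum_mset :: nat multiset \<Rightarrow> nat)"
  unfolding finfib_def
proof
  fix n
  show "finite {p \<in> msets_size k. sum_mset p = (n::nat)}"
    by (rule finite_subset[OF _ finite_mset_bounded[of n k]]) (auto simp: msets_size_def)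
qed

text \<open>Such a multiset avoids \<open>x\<close> or arises from another one of the same kind by
  adding one \<open>x\<close>.\<close>

lemma gf_msets_insert:
  fixes A :: "nat set"
  assumes "x \<notin> A" "0 \<notin> A" "0 < x"
  shows "(1 - fps_X ^ x) * gf (msets (insert x A)) sum_mset = gf (msets A) sum_mset"
proof -
  let ?B = "msets (insert x A)"
  have eq: "?B = msets A \<union> add_mset x ` ?B"
  proof (intro equalityI subsetI)
    fix p assume p: "p \<in> ?B"
    show "p \<in> msets A \<union> add_mset x ` ?B"
    proof (cases "x \<in># p")
      case True
      then have "p = add_mset x (p - {#x#})" "p - {#x#} \<in> ?B"
        using p by (auto simp: msets_def dest: in_diffD)
      then show ?thesis by blast
    next
      case False
      then show ?thesis using p by (auto simp: msets_def)
    qed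
  qed (auto simp: msets_def)
  have "gf (add_mset x ` ?B) sum_mset = fps_X ^ x * gf ?B sum_mset"
    by (rule gf_reindex[where f = "add_mset x"]) (auto simp: bij_betw_def inj_on_def)
  moreover have "gf (msets A \<union> add_mset x ` ?B) sum_mset
      = gf (msets A) sum_mset + gf (add_mset x ` ?B) sum_mset"
    using assms by (intro gf_Un) (auto simp: eq[symmetric] finfib_msets, auto simp: msets_def)
  ultimately show ?thesis using eq by (simp add: algebra_simps)
qed

text \<open>The series $1/(q)_k$.\<close>
definition part_gf :: "nat \<Rightarrow> int fps" where
  "part_gf k = gf (msets {1..k}) sum_mset"

lemma part_gf_0 [simp]: "part_gf 0 = 1"
proof (rule fps_ext)
  fix n
  have "{p \<in> msets {1..0}. sum_mset p = (n::nat)} = (if n = 0 then {{#}} else {})"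
    by (auto simp: msets_def)
  then show "part_gf 0 $ n = 1 $ n" by (simp add: part_gf_def gf_nth)
qed

lemma part_gf_Suc: "(1 - fps_X ^ Suc k) * part_gf (Suc k) = part_gf k"
  using gf_msets_insert[of "Suc k" "{1..k}"] by (simp add: part_gf_def atLeastAtMostSuc_conv)

lemma one_minus_X_power_neq_0:
  assumes "0 < k"
  shows "1 - fps_X ^ k \<noteq> (0 :: int fps)"
proof -
  have "(1 - fps_X ^ k :: int fps) $ 0 = 1" using assms by simp
  then show ?thesis by (metis fps_zero_nth zero_neq_one)
qed

lemma gf_msets_from_2: "0 < k \<Longrightarrow> gf (msets {2..k}) sum_mset = (1 - fps_X) * part_gf k"
  using gf_msets_insert[of 1 "{2..k}"]
  by (simp add: part_gf_def numeral_2_eq_2 atLeastAtMost_insertL)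

lemma sum_mset_image_add: "sum_mset (image_mset (\<lambda>x. x + c) p)
    = sum_mset p + c * size (p :: nat multiset)"
  by (induction p) auto

text \<open>This takes the place of conjugation. A multiset of size k + 1 either contains a zero,
  which can be removed, or has all elements positive and can be lowered by one throughout, at the
  cost of q^(k+1). The recurrence is that of \<open>part_gf_Suc\<close>.\<close>

lemma gf_msets_size: "gf (msets_size k) sum_mset = part_gf k"
proof (induction k)
  case 0
  have "msets_size 0 = (msets {1..0} :: nat multiset set)" by (auto simp: msets_size_def msets_def)
  then show ?case by (simp only: part_gf_def)
next
  case (Suc k)
  let ?B = "msets_size (Suc k) :: nat multiset set"
  have eq: "?B = add_mset 0 ` msets_size k \<union> image_mset (\<lambda>x. x + 1) ` ?B"
  proof (intro equalityI subsetI)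
    fix p assume p: "p \<in> ?B"
    show "p \<in> add_mset 0 ` msets_size k \<union> image_mset (\<lambda>x. x + 1) ` ?B"
    proof (cases "0 \<in># p")
      case True
      then have "p = add_mset 0 (p - {#0#})" "p - {#0#} \<in> msets_size k"
        using p by (auto simp: msets_size_def size_Diff_singleton)
      then show ?thesis by blast
    next
      case False
      then have "image_mset (\<lambda>x. x + 1) (image_mset (\<lambda>x. x - 1) p) = image_mset (\<lambda>x. x) p"
        unfolding multiset.map_comp by (intro image_mset_cong) (auto intro!: Suc_pred gr0I)
      then have "p = image_mset (\<lambda>x. x + 1) (image_mset (\<lambda>x. x - 1) p)" by simp
      moreover have "image_mset (\<lambda>x. x - 1) p \<in> ?B" using p by (auto simp: msets_size_def)
      ultimately show ?thesis by blast
    qed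
  qed (auto simp: msets_size_def)
  have "gf (add_mset 0 ` msets_size k) sum_mset = fps_X ^ 0 * gf (msets_size k) sum_mset"
    by (rule gf_reindex[where f = "add_mset 0"]) (auto simp: bij_betw_def inj_on_def)
  moreover have "inj (image_mset (\<lambda>x::nat. x + 1))"
    by (rule inj_on_inverseI[where g = "image_mset (\<lambda>x. x - 1)"])
        (simp add: multiset.map_comp comp_def)
  then have "gf (image_mset (\<lambda>x. x + 1) ` ?B) sum_mset = fps_X ^ Suc k * gf ?B sum_mset"
    by (intro gf_reindex[where f = "image_mset (\<lambda>x. x + 1)"])
      (auto simp: bij_betw_def sum_mset_image_add msets_size_def simp del: Suc_eq_plus1
          add_Suc_right intro: inj_on_subset)
  moreover have "gf (add_mset 0 ` msets_size k \<union> image_mset (\<lambda>x. x + 1) ` ?B) sum_mset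
      = gf (add_mset 0 ` msets_size k) sum_mset + gf (image_mset (\<lambda>x. x + 1) ` ?B) sum_mset"
  proof (rule gf_Un)
    show "finfib (add_mset 0 ` msets_size k \<union> image_mset (\<lambda>x. x + 1) ` ?B) sum_mset"
      unfolding eq[symmetric] by (rule finfib_msets_size)
    have "add_mset 0 p \<noteq> image_mset (\<lambda>x. x + 1) q" for p q :: "nat multiset"
      by (rule notI, drule arg_cong[of _ _ "\<lambda>r. 0 \<in># r"]) auto
    then show "add_mset 0 ` msets_size k \<inter> image_mset (\<lambda>x. x + 1) ` ?B = {}" by blast
  qed
  ultimately have "(1 - fps_X ^ Suc k) * gf ?B sum_mset = part_gf k"
    using eq Suc by (simp add: algebra_simps)
  then have "(1 - fps_X ^ Suc k) * gf ?B sum_mset = (1 - fps_X ^ Suc k) * part_gf (Suc k)"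
    by (simp only: part_gf_Suc)
  then show ?case using one_minus_X_power_neq_0[of "Suc k"] by (simp only: mult_cancel_left) simp
qed

text \<open>With $1 - q^{k+1} = (1 - q^w) + q^w (1 - q^{k+1-w})$, multiplication by $1 - q^{k+1}$ turns
  the sum for $(k + 1, a)$ into the sum for $(k, a + 1)$.\<close>
lemma Durfee_sum:
  "(\<Sum>w\<le>k. fps_X ^ (w * (w + a)) * part_gf w * part_gf (w + a) * part_gf (k - w))
      = part_gf k * part_gf (k + a)"
proof (induction k arbitrary: a)
  case 0
  then show ?case by simp
next
  case (Suc k)
  let ?X = "fps_X :: int fps"
  let ?t = "\<lambda>w. ?X ^ (w * (w + a)) * part_gf w * part_gf (w + a) * part_gf (Suc k - w)"
  let ?f = "\<lambda>w. ?X ^ (w * (w + a)) * ((1 - ?X ^ w) * part_gf w) * part_gf (w + a)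
      * part_gf (Suc k - w)"
  let ?g = "\<lambda>w. ?X ^ (w * (w + a) + w) * part_gf w * part_gf (w + a)
      * ((1 - ?X ^ (Suc k - w)) * part_gf (Suc k - w))"
  have "(1 - ?X ^ Suc k) * ?t w = ?f w + ?g w" if "w \<le> Suc k" for w
  proof -
    have "?X ^ Suc k = ?X ^ w * ?X ^ (Suc k - w)" using that by (simp flip: power_add)
    then show ?thesis by (simp only: power_add) (simp add: algebra_simps del: power_Suc)
  qed
  then have "(1 - ?X ^ Suc k) * (\<Sum>w\<le>Suc k. ?t w) = (\<Sum>w\<le>Suc k. ?f w) + (\<Sum>w\<le>Suc k. ?g w)"
    unfolding sum_distrib_left sum.distrib[symmetric] by (intro sum.cong) auto
  \<comment> \<open>The term w = 0 here and the term w = k + 1 of \<open>?g\<close> contain 1 - q^0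
    = 0. In the others that factor lowers the index of one \<open>part_gf\<close>.\<close>
  also have "(\<Sum>w\<le>Suc k. ?f w)
      = (\<Sum>w\<le>k. ?X ^ (Suc w * (Suc w + a)) * part_gf w * part_gf (Suc w + a) * part_gf (k - w))"
    unfolding sum.atMost_Suc_shift part_gf_Suc by simp
  also have "(\<Sum>w\<le>Suc k. ?g w)
      = (\<Sum>w\<le>k. ?X ^ (w * (w + a) + w) * part_gf w * part_gf (w + a) * part_gf (k - w))"
    by (simp add: Suc_diff_le part_gf_Suc del: power_Suc cong: sum.cong_simp)
  \<comment> \<open>The new factor 1 - q^(w+a+1) contributes a term with exponent (w+1)(w+a+1),
    which cancels the shifted sum of \<open>?f\<close>.\<close>
  also have "\<dots> = (\<Sum>w\<le>k. ?X ^ (w * (w + a) + w) * part_gf w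
      * ((1 - ?X ^ Suc (w + a)) * part_gf (Suc (w + a))) * part_gf (k - w))"
    by (simp only: part_gf_Suc)
  also have "(\<Sum>w\<le>k. ?X ^ (Suc w * (Suc w + a)) * part_gf w * part_gf (Suc w + a)
      * part_gf (k - w)) + \<dots>
      = (\<Sum>w\<le>k. ?X ^ (w * (w + Suc a)) * part_gf w * part_gf (w + Suc a) * part_gf (k - w))"
    unfolding sum.distrib[symmetric]
    by (intro sum.cong) (simp_all add: algebra_simps power_add)
  also have "\<dots> = part_gf k * part_gf (k + Suc a)" by (rule Suc.IH)
  also have "\<dots> = (1 - ?X ^ Suc k) * (part_gf (Suc k) * part_gf (Suc k + a))"
    by (simp only: part_gf_Suc mult.assoc[symmetric] add_Suc add_Suc_right)
  finally show ?case using one_minus_X_power_neq_0[of "Suc k"] by (simp only: mult_cancel_left) simp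
qed

text \<open>By Euler, this is $1/(q^a;q)_\infty$ for $a > 0$; it stands in for the infinite product
  throughout.\<close>
definition euler_sum :: "nat \<Rightarrow> int fps" where
  "euler_sum a = fsum (\<lambda>k. fps_X ^ (a * k) * part_gf k)"

text \<open>In q^(ak) - q^((a+1)k) = q^(ak) (1 - q^k) the last factor kills the term k = 0 and turns
  \<open>part_gf k\<close> into \<open>part_gf (k - 1)\<close> otherwise; shifting the index leaves
  q^a times the original series.\<close>

lemma euler_sum_Suc: "0 < a \<Longrightarrow> euler_sum (Suc a) = (1 - fps_X ^ a) * euler_sum a"
proof -
  assume a: "0 < a"
  let ?X = "fps_X :: int fps"
  have lf: "locfin (\<lambda>k. ?X ^ (a * k) * part_gf k)" using a by (intro locfin_X_power_mult) auto
  have "euler_sum a - euler_sum (Suc a) = fsum (\<lambda>k. ?X ^ (a * k) * ((1 - ?X ^ k) * part_gf k))"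
    unfolding euler_sum_def fsum_diff[symmetric] by (simp add: algebra_simps power_add)
  also have "\<dots> = ?X ^ a * euler_sum a"
    unfolding euler_sum_def fsum_mult_left[OF lf]
  proof (rule fps_ext)
    fix n
    \<comment> \<open>Truncating at \<open>Suc n\<close> leaves exactly the indices up to
      \<open>n\<close> once the vanishing term is dropped and the sum is shifted.\<close>
    have "fsum (\<lambda>k. ?X ^ (a * k) * ((1 - ?X ^ k) * part_gf k)) $ n
        = (\<Sum>k\<le>Suc n. (?X ^ (a * k) * ((1 - ?X ^ k) * part_gf k)) $ n)"
      using a by (intro fsum_nth_ge locfin_X_power_mult) auto
    also have "\<dots> = (\<Sum>k\<le>n. (?X ^ (a * Suc k) * part_gf k) $ n)"
      unfolding sum.atMost_Suc_shift part_gf_Suc by simp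
    finally show "fsum (\<lambda>k. ?X ^ (a * k) * ((1 - ?X ^ k) * part_gf k)) $ n
        = fsum (\<lambda>k. ?X ^ a * (?X ^ (a * k) * part_gf k)) $ n"
      by (simp add: fsum_def power_add mult.assoc)
  qed
  finally show ?thesis by (simp add: algebra_simps)
qed

lemma euler_sum_nth_le:
  assumes "i \<le> n"
  shows "euler_sum (Suc n) $ i = (if i = 0 then 1 else 0)"
proof -
  have "euler_sum (Suc n) $ i = (\<Sum>k\<le>i. if k = 0 then (1 :: int fps) $ i else 0)"
    unfolding euler_sum_def fsum_def fps_nth_Abs_fps
  proof (intro sum.cong refl)
    fix k
    have "k = 0 \<or> i < Suc n * k" using assms by (cases k) auto
    then show "(fps_X ^ (Suc n * k) * part_gf k) $ i = (if k = 0 then (1 :: int fps) $ i else 0)"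
      by (auto simp: fps_X_power_mult_nth simp del: mult_Suc)
  qed
  then show ?thesis by simp
qed

section \<open>Finite products, and the q-series identities for U_1 and U_2\<close>

definition qpoch :: "nat \<Rightarrow> int fps" where
  "qpoch n = (\<Prod>i=1..n. 1 - fps_X ^ i)"

lemma qpoch_Suc: "qpoch (Suc n) = qpoch n * (1 - fps_X ^ Suc n)"
  by (simp add: qpoch_def)

lemma qpoch_mult_part_gf: "qpoch n * part_gf n = 1"
proof (induction n)
  case (Suc n)
  then show ?case unfolding qpoch_Suc mult.assoc part_gf_Suc .
qed (simp add: qpoch_def)

lemma qpoch_mult_euler_sum: "qpoch n * euler_sum 1 = euler_sum (Suc n)"
proof (induction n)
  case (Suc n)
  then show ?case unfolding qpoch_Suc euler_sum_Suc[OF zero_less_Suc, of n]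
      by (simp add: mult_ac del: power_Suc)
qed (simp add: qpoch_def)

text \<open>The product 1/(q)_inf is cut after its first \<open>n\<close> factors; the tail is 1 up
  to degree \<open>n\<close>.\<close>

lemma euler_sum_1_eq: "euler_sum 1 = part_gf n * euler_sum (Suc n)"
  using qpoch_mult_part_gf[of n]
      by (simp only: qpoch_mult_euler_sum[symmetric] mult.assoc[symmetric]
          mult.commute[of "part_gf n"]) simp

text \<open>The index \<open>k\<close> is the maximal part minus one. At m = 0 the summands are not
  locally finite.\<close>

definition unimodal_gf :: "nat \<Rightarrow> int fps" where
  "unimodal_gf m = fsum (\<lambda>k. fps_X ^ (m * k) * (part_gf k)\<^sup>2)"

text \<open>The exponent is (w+1)^2 - 1, that of the class with \<open>w\<close> ones and
  \<open>w\<close> parts larger than \<open>w\<close>. Its factor 1 - q is kept outside.\<close>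

definition balanced_gf :: "int fps" where
  "balanced_gf = fsum (\<lambda>w. fps_X ^ (w * w + 2 * w) * (part_gf w)\<^sup>2)"

text \<open>The multiplier \<open>euler_sum 2\<close> is chosen because its weights q^(2(k-i))
  combine with q^(2i) to q^(2k). What remains on each diagonal is \<open>Durfee_sum\<close> at a =
  0. The factor 1 - q then comes from \<open>euler_sum_Suc\<close>.\<close>

lemma unimodal_gf_2: "unimodal_gf 2 = euler_sum 1 * ((1 - fps_X) * balanced_gf)"
proof -
  let ?X = "fps_X :: int fps"
  have "balanced_gf * euler_sum 2
      = fsum (\<lambda>k. \<Sum>i\<le>k. (?X ^ (i * i + 2 * i) * (part_gf i)\<^sup>2)
          * (?X ^ (2 * (k - i)) * part_gf (k - i)))"
    unfolding balanced_gf_def euler_sum_def by (intro fsum_mult_fsum locfin_X_power_mult) auto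
  also have "\<dots> = unimodal_gf 2"
    unfolding unimodal_gf_def
  proof (rule arg_cong[of _ _ fsum], rule ext)
    fix k
    have "(\<Sum>i\<le>k. (?X ^ (i * i + 2 * i) * (part_gf i)\<^sup>2) * (?X ^ (2 * (k - i)) * part_gf (k - i)))
        = (\<Sum>i\<le>k. ?X ^ (2 * k)
            * (?X ^ (i * (i + 0)) * part_gf i * part_gf (i + 0) * part_gf (k - i)))"
    proof (intro sum.cong refl)
      fix i assume "i \<in> {..k}"
      then have "?X ^ (2 * k) = ?X ^ (2 * i) * ?X ^ (2 * (k - i))" by (simp flip: power_add)
      then show "(?X ^ (i * i + 2 * i) * (part_gf i)\<^sup>2) * (?X ^ (2 * (k - i)) * part_gf (k - i))
          = ?X ^ (2 * k) * (?X ^ (i * (i + 0)) * part_gf i * part_gf (i + 0) * part_gf (k - i))"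
        by (simp add: power_add power2_eq_square mult_ac)
    qed
    also have "\<dots> = ?X ^ (2 * k) * (part_gf k)\<^sup>2"
      unfolding sum_distrib_left[symmetric] Durfee_sum by (simp add: power2_eq_square)
    finally show "(\<Sum>i\<le>k. (?X ^ (i * i + 2 * i) * (part_gf i)\<^sup>2)
        * (?X ^ (2 * (k - i)) * part_gf (k - i)))
        = ?X ^ (2 * k) * (part_gf k)\<^sup>2" .
  qed
  finally show ?thesis using euler_sum_Suc[of 1] by (simp add: numeral_2_eq_2 mult_ac)
qed

text \<open>Since 2 q^k - q^(2k) = 1 - (1 - q^k)^2, the term at k > 0 is the difference of the
  squares of \<open>part_gf k\<close> and \<open>part_gf (k - 1)\<close>.\<close>

lemma unimodal_gf_1: "2 * unimodal_gf 1 - unimodal_gf 2 = (euler_sum 1)\<^sup>2"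
proof (rule fps_ext)
  fix n
  let ?X = "fps_X :: int fps"
  have tel: "(\<Sum>k\<le>n. (2 * ?X ^ k - ?X ^ (2 * k)) * (part_gf k)\<^sup>2) = (part_gf n)\<^sup>2"
  proof (induction n)
    case (Suc n)
    have "(part_gf n)\<^sup>2 = ((1 - ?X ^ Suc n) * part_gf (Suc n))\<^sup>2" by (simp only: part_gf_Suc)
    also have "\<dots> = (1 - (2 * ?X ^ Suc n - ?X ^ (2 * Suc n))) * (part_gf (Suc n))\<^sup>2"
      unfolding mult_2 power_add
          by (simp only: power2_eq_square) (simp add: algebra_simps del: power_Suc)
    finally show ?case using Suc by (simp add: algebra_simps del: power_Suc)
  qed simp
  have "(2 * unimodal_gf 1 - unimodal_gf 2) $ n
      = (unimodal_gf 1 + unimodal_gf 1 - unimodal_gf 2) $ n" by (simp only: mult_2)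
  also have "\<dots> = (\<Sum>k\<le>n. (2 * ?X ^ k - ?X ^ (2 * k)) * (part_gf k)\<^sup>2) $ n"
  proof -
    have "(2 * ?X ^ k - ?X ^ (2 * k)) * (part_gf k)\<^sup>2
        = ?X ^ k * (part_gf k)\<^sup>2 + ?X ^ k * (part_gf k)\<^sup>2 - ?X ^ (2 * k) * (part_gf k)\<^sup>2" for k
      by (simp add: algebra_simps)
    then show ?thesis
      by (simp only: unimodal_gf_def fsum_def fps_sum_nth fps_add_nth fps_sub_nth fps_nth_Abs_fps
          sum.distrib sum_subtractf mult_1)
  qed
  also have "\<dots> = (part_gf n)\<^sup>2 $ n" by (simp only: tel)
  also have "\<dots> = ((part_gf n)\<^sup>2 * euler_sum (Suc n) * euler_sum (Suc n)) $ n"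
    using euler_sum_nth_le by (simp add: fps_mult_nth_one_upto)
  also have "\<dots> = (euler_sum 1)\<^sup>2 $ n"
    unfolding euler_sum_1_eq[of n] by (simp add: power2_eq_square mult_ac)
  finally show "(2 * unimodal_gf 1 - unimodal_gf 2) $ n = (euler_sum 1)\<^sup>2 $ n" .
qed

section \<open>The pentagonal number theorem in finite form\<close>

definition pent :: "int \<Rightarrow> int" where
  "pent j = j * (3 * j - 1) div 2"

definition pent_poly :: "nat \<Rightarrow> int fps" where
  "pent_poly n = (\<Sum>j=-int n..int n. (-1) ^ nat \<bar>j\<bar> * fps_X ^ nat (pent j))"

lemma double_sum_atMost: "2 * \<Sum>{..n} = n * Suc n"
  by (induction n) (auto simp: algebra_simps)

text \<open>Square plus triangular number is the form in which these exponents arise at the boundary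
  of the sum in \<open>shanks_sum_step\<close>.\<close>

lemma nat_pent:
  "nat (pent (int (Suc n))) = Suc n * Suc n + \<Sum>{..n}"
  "nat (pent (- int (Suc n))) = Suc n * Suc n + \<Sum>{..Suc n}"
proof -
  have s: "2 * int (\<Sum>{..n}) = int n * (int n + 1)" for n
    using double_sum_atMost[of n, THEN arg_cong[of _ _ int]] by (simp add: algebra_simps)
  have "int (Suc n) * (3 * int (Suc n) - 1) = 2 * int (Suc n * Suc n + \<Sum>{..n})"
    using s[of n] by (simp add: algebra_simps)
  then show "nat (pent (int (Suc n))) = Suc n * Suc n + \<Sum>{..n}"
    unfolding pent_def by (simp del: of_nat_Suc of_nat_add of_nat_mult)
  have "- int (Suc n) * (3 * (- int (Suc n)) - 1) = 2 * int (Suc n * Suc n + \<Sum>{..Suc n})"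
    using s[of "Suc n"] by (simp add: algebra_simps del: sum.atMost_Suc)
  then show "nat (pent (- int (Suc n))) = Suc n * Suc n + \<Sum>{..Suc n}"
    unfolding pent_def by (simp del: of_nat_Suc of_nat_add of_nat_mult sum.atMost_Suc)
qed

lemma abs_le_pent: "\<bar>j\<bar> \<le> pent j"
proof -
  have "0 \<le> (\<bar>j\<bar> - 1) * \<bar>j\<bar>" by (cases "j = 0") auto
  then have "3 * \<bar>j\<bar> \<le> 3 * (j * j)" by (simp add: algebra_simps)
  moreover have "j * (3 * j - 1) = 3 * (j * j) - j" by (simp add: algebra_simps)
  ultimately show ?thesis unfolding pent_def by linarith
qed

text \<open>Modulo $q^{n+1}$ only the summand $s = 0$ survives.\<close>
definition shanks_sum :: "nat \<Rightarrow> int fps" where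
  "shanks_sum n = (\<Sum>s\<le>n. fps_X ^ (s * n + \<Sum>{..s}) * ((-1) ^ s * part_gf s))"

text \<open>The difference telescopes over s up to \<open>n\<close>. The boundary term left there
  and the additional summand s = n + 1 carry the two pentagonal exponents that are new at n +
  1.\<close>

lemma shanks_sum_step:
  "(1 - fps_X ^ Suc n) * shanks_sum (Suc n) - shanks_sum n
    = (-1) ^ Suc n * part_gf n
        * (fps_X ^ (Suc n * Suc n + \<Sum>{..Suc n}) + fps_X ^ (Suc n * Suc n + \<Sum>{..n}))"
proof -
  let ?X = "fps_X :: int fps"
  define t :: "nat \<Rightarrow> nat" where "t s = \<Sum>{..s}" for s
  have t_Suc: "t (Suc s) = t s + Suc s" for s by (simp add: t_def)
  have tel: "(\<Sum>s\<le>M. (1 - ?X ^ Suc n) * (?X ^ (s * Suc n + t s) * ((-1) ^ s * part_gf s))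
        - ?X ^ (s * n + t s) * ((-1) ^ s * part_gf s))
      = - ((-1) ^ M * part_gf M * ?X ^ (Suc M * Suc n + t M))" for M
  proof (induction M)
    case 0
    then show ?case by (simp add: t_def algebra_simps)
  next
    case (Suc M)
    define x where "x = ?X ^ Suc M"
    define z where "z = ?X ^ Suc n"
    define Y where "Y = ?X ^ (Suc M * Suc n + t M)"
    have e: "?X ^ (Suc M * Suc n + t (Suc M)) = Y * x"
      "?X ^ (Suc M * n + t (Suc M)) = Y"
      "?X ^ (Suc (Suc M) * Suc n + t (Suc M)) = z * Y * x"
      unfolding x_def z_def Y_def power_add[symmetric] t_Suc
      by (rule arg_cong[of _ _ "(^) ?X"], simp)+
    have HM: "part_gf M = (1 - x) * part_gf (Suc M)" unfolding x_def
        by (rule part_gf_Suc[symmetric])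
    show ?case
      unfolding sum.atMost_Suc[of _ M] Suc.IH e unfolding Y_def[symmetric] z_def[symmetric] HM
      by (simp add: algebra_simps)
  qed
  have "(1 - ?X ^ Suc n) * shanks_sum (Suc n) - shanks_sum n
      = (\<Sum>s\<le>n. (1 - ?X ^ Suc n) * (?X ^ (s * Suc n + t s) * ((-1) ^ s * part_gf s))
        - ?X ^ (s * n + t s) * ((-1) ^ s * part_gf s))
        + (1 - ?X ^ Suc n) * (?X ^ (Suc n * Suc n + t (Suc n)) * ((-1) ^ Suc n * part_gf (Suc n)))"
    unfolding shanks_sum_def t_def sum.atMost_Suc[of _ n] sum_subtractf sum_distrib_left
        distrib_left
    by (simp only: diff_add_eq)
  also have "\<dots> = - ((-1) ^ n * part_gf n * ?X ^ (Suc n * Suc n + t n))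
      + ?X ^ (Suc n * Suc n + t (Suc n)) * ((-1) ^ Suc n * ((1 - ?X ^ Suc n) * part_gf (Suc n)))"
    unfolding tel by (simp only: mult_ac)
  also have "\<dots>
      = (-1) ^ Suc n * part_gf n * (?X ^ (Suc n * Suc n + t (Suc n)) + ?X ^ (Suc n * Suc n + t n))"
    unfolding part_gf_Suc by (simp only: power_Suc[of "-1"]) (simp add: distrib_left mult_ac)
  finally show ?thesis unfolding t_def .
qed

text \<open>Multiplied by \<open>qpoch n\<close>, which cancels \<open>part_gf n\<close>, the
  increment in \<open>shanks_sum_step\<close> becomes the two monomials for j = n + 1 and j = -(n +
  1).\<close>

lemma pent_poly_eq: "pent_poly n = qpoch n * shanks_sum n"
proof (induction n)
  case 0
  then show ?case by (simp add: pent_poly_def qpoch_def shanks_sum_def pent_def)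
next
  case (Suc n)
  let ?X = "fps_X :: int fps"
  have "{-int (Suc n)..int (Suc n)} = insert (int (Suc n)) (insert (- int (Suc n)) {-int n..int n})"
    by auto
  then have "pent_poly (Suc n) = (-1) ^ Suc n * ?X ^ nat (pent (int (Suc n)))
      + ((-1) ^ Suc n * ?X ^ nat (pent (- int (Suc n))) + pent_poly n)"
    by (simp add: pent_poly_def nat_add_distrib)
  also have "\<dots>
      = (-1) ^ Suc n * (?X ^ (Suc n * Suc n + \<Sum>{..Suc n}) + ?X ^ (Suc n * Suc n + \<Sum>{..n}))
          + pent_poly n"
    unfolding nat_pent distrib_left by (simp only: add_ac)
  also have "\<dots> = qpoch n * part_gf n * ((-1) ^ Suc n
      * (?X ^ (Suc n * Suc n + \<Sum>{..Suc n}) + ?X ^ (Suc n * Suc n + \<Sum>{..n})))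
          + qpoch n * shanks_sum n"
    unfolding qpoch_mult_part_gf Suc by simp
  also have "\<dots>
      = qpoch n * ((1 - ?X ^ Suc n) * shanks_sum (Suc n) - shanks_sum n) + qpoch n * shanks_sum n"
    unfolding shanks_sum_step by (simp only: mult_ac)
  also have "\<dots> = qpoch (Suc n) * shanks_sum (Suc n)"
    unfolding qpoch_Suc
        by (simp only: right_diff_distrib[of "qpoch n" _ "shanks_sum n"] diff_add_cancel mult.assoc)
  finally show ?case .
qed

lemma shanks_sum_nth_le:
  assumes "i \<le> n"
  shows "shanks_sum n $ i = (if i = 0 then 1 else 0)"
proof -
  have "shanks_sum n $ i = (\<Sum>s\<le>n. if s = 0 then (1 :: int fps) $ i else 0)"
    unfolding shanks_sum_def fps_sum_nth
  proof (intro sum.cong refl)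
    fix s
    have "s = 0 \<or> i < s * n + \<Sum>{..s}" using assms by (cases s) auto
    then show "(fps_X ^ (s * n + \<Sum>{..s}) * ((-1) ^ s * part_gf s)) $ i
        = (if s = 0 then (1 :: int fps) $ i else 0)"
      by (auto simp: fps_X_power_mult_nth)
  qed
  then show ?thesis by simp
qed

text \<open>Euler's theorem in usable form: the two series that multiply \<open>V\<close> are both 1
  modulo q^(n+1).\<close>

lemma pent_poly_mult_euler_sum_nth: "(pent_poly n * (euler_sum 1 * V)) $ n = V $ n"
proof -
  have "pent_poly n * (euler_sum 1 * V) = V * shanks_sum n * euler_sum (Suc n)"
      by (simp only: pent_poly_eq qpoch_mult_euler_sum[symmetric] mult_ac)
  then show ?thesis by (simp only: fps_mult_nth_one_upto shanks_sum_nth_le euler_sum_nth_le)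
qed

text \<open>By \<open>abs_le_pent\<close> the support lies in -n..n, so the sum is a coefficient of
  a product with \<open>pent_poly n\<close>.\<close>

lemma pentagonal_sum_eq:
  fixes g :: "int \<Rightarrow> int"
  assumes g: "\<And>i. i < 0 \<Longrightarrow> g i = 0" "\<And>i. 0 \<le> i \<Longrightarrow> g i = (euler_sum 1 * V) $ nat i"
  shows "Sum_any (\<lambda>j::int. (-1) ^ nat \<bar>j\<bar> * g (int n - pent j)) = V $ n"
proof -
  have "Sum_any (\<lambda>j::int. (-1) ^ nat \<bar>j\<bar> * g (int n - pent j))
      = (\<Sum>j=-int n..int n. (-1) ^ nat \<bar>j\<bar> * g (int n - pent j))"
  proof (rule Sum_any.expand_superset)
    show "{j. (-1) ^ nat \<bar>j\<bar> * g (int n - pent j) \<noteq> 0} \<subseteq> {-int n..int n}"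
    proof
      fix j assume "j \<in> {j. (-1) ^ nat \<bar>j\<bar> * g (int n - pent j) \<noteq> 0}"
      then have "\<not> int n - pent j < 0" using g(1) by auto
      then show "j \<in> {-int n..int n}" using abs_le_pent[of j] by auto
    qed
  qed simp
  also have "\<dots> = (pent_poly n * (euler_sum 1 * V)) $ n"
    unfolding pent_poly_def sum_distrib_right fps_sum_nth
  proof (intro sum.cong refl)
    fix j
    have "0 \<le> pent j" using abs_le_pent[of j] by linarith
    then have "g (int n - pent j) = (fps_X ^ nat (pent j) * (euler_sum 1 * V)) $ n"
      using g by (auto simp: fps_X_power_mult_nth nat_diff_distrib)
    then show "(-1) ^ nat \<bar>j\<bar> * g (int n - pent j)
        = ((-1) ^ nat \<bar>j\<bar> * fps_X ^ nat (pent j) * (euler_sum 1 * V)) $ n"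
      by (simp add: minus_one_power_iff mult.assoc)
  qed
  also have "\<dots> = V $ n" by (rule pent_poly_mult_euler_sum_nth)
  finally show ?thesis .
qed

section \<open>Unimodal compositions\<close>

text \<open>Cutting at the last maximal part makes the decomposition unique: \<open>ys\<close> may
  still contain \<open>k\<close>, \<open>zs\<close> may not. The index in \<open>unimodal\<close>
  may point to any maximal part.\<close>

lemma unimodal_iff_last_max:
  "unimodal xs \<and> Max (set xs) = k \<longleftrightarrow>
    (\<exists>ys zs. xs = ys @ k # zs \<and> sorted ys \<and> sorted (rev zs)
      \<and> (\<forall>y\<in>set ys. y \<le> k) \<and> (\<forall>z\<in>set zs. z < k))" (is "?L \<longleftrightarrow> ?R")
proof
  assume ?R
  then obtain ys zs where *: "xs = ys @ k # zs" "sorted ys" "sorted (rev zs)"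
    "\<forall>y\<in>set ys. y \<le> k" "\<forall>z\<in>set zs. z < k" by blast
  have "sorted_wrt (\<ge>) zs" using *(3) by (simp add: sorted_wrt_rev)
  then have "sorted_wrt (\<le>) (take (Suc (length ys)) xs) \<and> sorted_wrt (\<ge>) (drop (length ys) xs)"
    using * by (auto simp: sorted_wrt_append less_imp_le)
  then have "unimodal xs" unfolding unimodal_def using *(1) by (intro exI[of _ "length ys"]) simp
  moreover have "Max (set xs) = k" using * by (intro Max_eqI) (auto simp: less_imp_le)
  ultimately show ?L by simp
next
  assume L: ?L
  then obtain t where t: "t < length xs" "sorted_wrt (\<le>) (take (Suc t) xs)" "sorted_wrt (\<ge>)
      (drop t xs)"
    by (auto simp: unimodal_def)
  have le: "x \<le> k" if "x \<in> set xs" for x using L that by auto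
  have "k \<in> set xs" using L t(1) Max_in[of "set xs"] by fastforce
  then obtain ys zs where xs: "xs = ys @ k # zs" "k \<notin> set zs"
    using split_list_last by metis
  have up: "xs ! i \<le> xs ! j" if "i < j" "j \<le> t" for i j
    using sorted_wrt_nth_less[OF t(2), of i j] that t(1) by simp
  have down: "xs ! j \<le> xs ! i" if "t \<le> i" "i < j" "j < length xs" for i j
    using sorted_wrt_nth_less[OF t(3), of "i - t" "j - t"] that by simp
  \<comment> \<open>On whichever side of \<open>t\<close> the last \<open>k\<close> lies,
    monotonicity on that side gives \<open>k \<le> xs ! t\<close>.\<close>
  have nth_t: "xs ! t = k"
  proof -
    have k: "xs ! length ys = k" "length ys < length xs" using xs by auto
    consider "length ys < t" | "length ys = t" | "t < length ys" by linarith
    then show ?thesis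
      using le[of "xs ! t"] k t(1) up[of "length ys" t] down[of t "length ys"]
      by cases (auto intro: antisym)
  qed
  have tle: "t \<le> length ys"
  proof (rule ccontr)
    assume "\<not> t \<le> length ys"
    then have "xs ! t = zs ! (t - Suc (length ys))" "t - Suc (length ys) < length zs"
      using xs(1) t(1) by (auto simp: nth_append nth_Cons')
    then show False using nth_t xs(2) nth_mem by metis
  qed
  have "sorted ys"
    unfolding sorted_iff_nth_mono_less
  proof (intro allI impI)
    fix i j assume ij: "i < j" "j < length ys"
    have nth: "xs ! i = ys ! i" "xs ! j = ys ! j" using ij xs(1) by (auto simp: nth_append)
    show "ys ! i \<le> ys ! j"
    proof (cases "j \<le> t")
      case True
      then show ?thesis using up[OF ij(1)] nth by simp
    next
      \<comment> \<open>Here \<open>j\<close> lies between \<open>t\<close> and the last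
        \<open>k\<close>, so \<open>xs ! j\<close> is at least \<open>k\<close>.\<close>
      case False
      then have "xs ! length ys \<le> xs ! j" using ij xs(1) by (intro down) auto
      moreover have "ys ! i \<le> k" using le[of "ys ! i"] ij xs(1) by simp
      ultimately show ?thesis using nth xs(1) by simp
    qed
  qed
  moreover have "sorted_wrt (\<ge>) (k # zs)"
  proof -
    have "drop t xs = drop t ys @ k # zs" using tle xs(1) by simp
    then show ?thesis using t(3) by (simp add: sorted_wrt_append)
  qed
  then have "sorted (rev zs)" by (simp add: sorted_wrt_rev)
  moreover have "\<forall>y\<in>set ys. y \<le> k" using le xs(1) by auto
  moreover have "\<forall>z\<in>set zs. z < k" using le xs
      by (metis UnCI le_neq_implies_less list.set_intros(2) set_append)
  ultimately show ?R using xs(1) by blast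
qed

definition pos_unimodal :: "nat list set" where
  "pos_unimodal = {xs. 0 \<notin> set xs \<and> unimodal xs}"

lemma unimodal_compositions_eq: "unimodal_compositions n = {xs \<in> pos_unimodal. sum_list xs = n}"
  unfolding unimodal_compositions_def compositions_def pos_unimodal_def
  by (auto, metis gr0I)

lemma finfib_pos_unimodal: "finfib pos_unimodal sum_list"
  unfolding finfib_def
proof
  fix n
  have "length xs \<le> sum_list xs" if "0 \<notin> set xs" for xs :: "nat list"
    using that by (induction xs) auto
  then have "{xs \<in> pos_unimodal. sum_list xs = n} \<subseteq> {xs. set xs \<subseteq> {..n} \<and> length xs \<le> n}"
    by (auto simp: pos_unimodal_def intro: member_le_sum_list)
  then show "finite {xs \<in> pos_unimodal. sum_list xs = n}"
    by (rule finite_subset) (simp add: finite_lists_length_le)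
qed

lemma sum_list_sorted_list_of_multiset: "sum_list (sorted_list_of_multiset p)
    = sum_mset (p :: nat multiset)"
  by (metis mset_sorted_list_of_multiset sum_mset_sum_list)

lemma takeWhile_less:
  "\<forall>x\<in>set xs. x < k \<Longrightarrow> takeWhile (\<lambda>x. x < k) (xs @ k # ys) = xs" for k :: "'a::preorder"
  by (induction xs) auto

text \<open>For \<open>Suc l = k\<close> exactly \<open>m\<close> maximal parts are split off, for \<open>l = k\<close> only the last \<open>m\<close> ones.\<close>
lemma gf_unimodal_Max:
  assumes m: "0 < m" and l: "l = k \<or> Suc l = k"
  defines "S \<equiv>
      {xs \<in> pos_unimodal. Max (set xs) = k \<and> m \<le> count_list xs k \<and> (l < k \<longrightarrow> count_list xs k = m)}"
  assumes k: "0 < k"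
  shows "gf S sum_list = fps_X ^ (m * k) * (part_gf l * part_gf (k - 1))"
proof -
  define f :: "nat multiset \<times> nat multiset \<Rightarrow> nat list" where
    "f = (\<lambda>(a, b). sorted_list_of_multiset a @ replicate m k @ rev (sorted_list_of_multiset b))"
  \<comment> \<open>Read backwards, the list shows its falling side before the first
    \<open>k\<close>; the rising side is what remains as a multiset after removing \<open>m\<close>
    copies of \<open>k\<close>.\<close>
  define g :: "nat list \<Rightarrow> nat multiset \<times> nat multiset" where
    "g xs = (let b
        = mset (takeWhile (\<lambda>x. x < k) (rev xs)) in (mset xs - replicate_mset m k - b, b))" for xs
  \<comment> \<open>The first form isolates the last \<open>k\<close> as the peak, the second the
    \<open>k\<close> that stops \<open>takeWhile\<close> in the reversed list.\<close>
  have rep: "replicate m k = replicate (m - 1) k @ [k]" "replicate m k = k # replicate (m - 1) k"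
    using m by (cases m; simp add: replicate_append_same)+
  have bij: "bij_betw f (msets {1..l} \<times> msets {1..k - 1}) S"
  proof (rule bij_betwI[of _ _ _ g])
    show "f \<in> msets {1..l} \<times> msets {1..k - 1} \<rightarrow> S"
    proof
      fix ab :: "nat multiset \<times> nat multiset"
      assume "ab \<in> msets {1..l} \<times> msets {1..k - 1}"
      then obtain a b where ab: "ab = (a, b)" "set_mset a \<subseteq> {1..l}" "set_mset b \<subseteq> {1..k - 1}"
        by (auto simp: msets_def)
      have a: "\<And>x. x \<in># a \<Longrightarrow> 0 < x \<and> x \<le> l" using ab by auto
      have b: "\<And>x. x \<in># b \<Longrightarrow> 0 < x \<and> x < k" using ab by fastforce
      have "f ab = (sorted_list_of_multiset a @ replicate (m - 1) k) @ k # rev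
          (sorted_list_of_multiset b)"
        unfolding f_def ab rep(1) by simp
      moreover have "sorted (sorted_list_of_multiset a @ replicate (m - 1) k)"
        using a l by (fastforce simp: sorted_append)
      ultimately have "unimodal (f ab) \<and> Max (set (f ab)) = k"
        unfolding unimodal_iff_last_max using a b l
        by (intro exI[of _ "sorted_list_of_multiset a @ replicate (m - 1) k"]
              exI[of _ "rev (sorted_list_of_multiset b)"]) (simp, fastforce)
      moreover have "0 \<notin> set (f ab)" using a b k by (auto simp: f_def ab)
      moreover have "count_list (f ab) k = count a k + m + count b k"
        unfolding count_mset[symmetric] f_def ab by simp
      moreover have "k \<notin># b" using b by blast
      moreover have "l < k \<Longrightarrow> k \<notin># a" using a by fastforce
      ultimately show "f ab \<in> S" by (auto simp: S_def pos_unimodal_def not_in_iff)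
    qed
    show "g (f ab) = ab" if mem: "ab \<in> msets {1..l} \<times> msets {1..k - 1}" for ab
    proof -
      obtain a b where ab: "ab = (a, b)" "set_mset b \<subseteq> {1..k - 1}" using mem
          by (cases ab) (auto simp: msets_def)
      have "rev (f ab)
          = sorted_list_of_multiset b @ k # replicate (m - 1) k @ rev (sorted_list_of_multiset a)"
        unfolding f_def ab by (simp add: rep(2) replicate_append_same)
      moreover have "\<forall>x\<in>set (sorted_list_of_multiset b). x < k" using ab(2) k by fastforce
      ultimately have "takeWhile (\<lambda>x. x < k) (rev (f ab)) = sorted_list_of_multiset b"
        by (simp only: takeWhile_less)
      then show ?thesis by (simp add: g_def f_def ab)
    qed
    have fg: "f (g xs) = xs \<and> g xs \<in> msets {1..l} \<times> msets {1..k - 1}" if xs: "xs \<in> S" for xs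
    proof -
      obtain ys zs where yz: "xs = ys @ k # zs" "sorted ys" "sorted (rev zs)"
        "\<forall>y\<in>set ys. y \<le> k" "\<forall>z\<in>set zs. z < k"
        using xs unimodal_iff_last_max[of xs k] by (auto simp: S_def pos_unimodal_def)
      define a where "a = mset (ys @ [k]) - replicate_mset m k"
      have b: "takeWhile (\<lambda>x. x < k) (rev xs) = rev zs"
        using yz by (simp add: takeWhile_less)
      have "mset xs - replicate_mset m k - mset zs
          = mset (ys @ [k]) + mset zs - mset zs - replicate_mset m k"
        unfolding yz(1) by (subst diff_right_commute) (simp add: union_ac)
      then have g: "g xs = (a, mset zs)" unfolding g_def b Let_def a_def by simp
      have cnt: "count (mset (ys @ [k])) k = count_list xs k"
        using yz by (auto simp: count_mset count_list_0_iff)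
      then have "replicate_mset m k \<subseteq># mset (ys @ [k])"
        using xs by (simp add: S_def count_le_replicate_mset_subset_eq[symmetric])
      then have a: "a + replicate_mset m k = mset (ys @ [k])" unfolding a_def by simp
      have mem: "x \<in> set ys \<or> x = k" if "x \<in># a" for x
        using that in_diffD[of x "mset (ys @ [k])" "replicate_mset m k"] by (auto simp: a_def)
      \<comment> \<open>A sorted list is determined by its multiset, so \<open>m\<close> copies of
        \<open>k\<close> stand at its end.\<close>
      have "sort (ys @ [k]) = sorted_list_of_multiset a @ replicate m k"
        using a mem yz(4) by (intro properties_for_sort) (auto simp: sorted_append)
      moreover have "sort (ys @ [k]) = ys @ [k]" using yz
          by (intro sorted_sort_id) (simp add: sorted_append)
      moreover have "sorted_list_of_multiset (mset zs) = rev zs"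
        using yz(3) by (metis mset_rev sorted_list_of_multiset_mset sorted_sort_id)
      ultimately have "f (g xs) = xs" unfolding g f_def using yz(1) by simp
      moreover have "x \<in> {1..l}" if "x \<in># a" for x
      proof -
        have "0 < x" using mem[OF that] xs yz(1) k
            by (auto simp: S_def pos_unimodal_def intro: gr0I)
        moreover have "x \<le> k" using mem[OF that] yz(4) by auto
        \<comment> \<open>Here all copies of \<open>k\<close> are among the \<open>m\<close> split
          off.\<close>
        moreover have "x \<noteq> k" if "l < k"
        proof -
          have "count a k + m = count_list xs k" using a cnt
              by (metis count_replicate_mset count_union)
          then have "count a k = 0" using xs that by (simp add: S_def)
          then show ?thesis using \<open>x \<in># a\<close> by (metis not_in_iff)
        qed
        ultimately show ?thesis using l by auto
      qed
      moreover have "set zs \<subseteq> {1..k - 1}"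
        using yz xs by (fastforce simp: S_def pos_unimodal_def Suc_le_eq intro: gr0I)
      ultimately show ?thesis unfolding g by (auto simp: msets_def)
    qed
    then show "g \<in> S \<rightarrow> msets {1..l} \<times> msets {1..k - 1}" "\<And>xs. xs \<in> S \<Longrightarrow> f (g xs) = xs" by auto
  qed
  have "gf S sum_list
      = fps_X ^ (m * k) * gf (msets {1..l} \<times> msets {1..k - 1}) (\<lambda>(a, b). sum_mset a + sum_mset b)"
    using bij by (rule gf_reindex)
        (auto simp: f_def sum_list_sorted_list_of_multiset sum_list_replicate)
  then show ?thesis by (simp add: gf_Times finfib_msets part_gf_def)
qed

lemma pos_unimodal_Max:
  assumes "xs \<in> pos_unimodal"
  shows "0 < Max (set xs)" "Max (set xs) - 1 \<le> sum_list xs" "0 < count_list xs (Max (set xs))"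
proof -
  have "xs \<noteq> []" using assms by (auto simp: pos_unimodal_def unimodal_def)
  then have M: "Max (set xs) \<in> set xs" by simp
  then show "0 < Max (set xs)" using assms by (auto simp: pos_unimodal_def intro: gr0I)
  have "Max (set xs) \<le> sum_list xs" using M by (intro member_le_sum_list) auto
  then show "Max (set xs) - 1 \<le> sum_list xs" by simp
  show "0 < count_list xs (Max (set xs))" using M by (metis count_list_0_iff gr0I)
qed

text \<open>Both sides of the block of maximal parts k + 1 have parts at most \<open>k\<close>,
  hence the square. The factor q^m accounts for counting compositions of n + m.\<close>

lemma gf_unimodal_count_Max:
  assumes "0 < m"
  shows "gf {xs \<in> pos_unimodal. count_list xs (Max (set xs)) = m} sum_list
      = fps_X ^ m * unimodal_gf m"
proof -
  let ?S = "{xs \<in> pos_unimodal. count_list xs (Max (set xs)) = m}"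
  have "gf ?S sum_list = fsum (\<lambda>k. gf {xs \<in> ?S. Max (set xs) - 1 = k} sum_list)"
    using finfib_subset[OF finfib_pos_unimodal, of ?S] pos_unimodal_Max(2)
    by (intro gf_fsum) auto
  also have "(\<lambda>k. gf {xs \<in> ?S. Max (set xs) - 1 = k} sum_list)
      = (\<lambda>k. fps_X ^ m * (fps_X ^ (m * k) * (part_gf k)\<^sup>2))"
  proof
    fix k
    have "{xs \<in> ?S. Max (set xs) - 1 = k} = {xs \<in> pos_unimodal. Max (set xs) = Suc k
        \<and> m \<le> count_list xs (Suc k) \<and> (k < Suc k \<longrightarrow> count_list xs (Suc k) = m)}"
      using pos_unimodal_Max(1) by force
    also have "gf \<dots> sum_list = fps_X ^ (m * Suc k) * (part_gf k * part_gf (Suc k - 1))"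
      using assms by (intro gf_unimodal_Max) auto
    finally show "gf {xs \<in> ?S. Max (set xs) - 1 = k} sum_list
        = fps_X ^ m * (fps_X ^ (m * k) * (part_gf k)\<^sup>2)"
      by (simp add: power_add power2_eq_square mult_ac)
  qed
  also have "fsum \<dots> = fps_X ^ m * unimodal_gf m"
    unfolding unimodal_gf_def using assms
        by (intro fsum_mult_left[symmetric] locfin_X_power_mult) auto
  finally show ?thesis .
qed

text \<open>Only the last maximal part k + 1 is split off, so the sides give
  \<open>part_gf (Suc k)\<close> and \<open>part_gf k\<close>. Rewriting the latter by
  \<open>part_gf_Suc\<close> and shifting the index yields (q^k - q^(2k)) times a square.\<close>

lemma gf_pos_unimodal: "gf pos_unimodal sum_list = unimodal_gf 1 - unimodal_gf 2"
proof (rule fps_ext)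
  fix n
  let ?X = "fps_X :: int fps"
  have "gf pos_unimodal sum_list = fsum (\<lambda>k. gf {xs \<in> pos_unimodal. Max (set xs) - 1 = k} sum_list)"
    using finfib_pos_unimodal pos_unimodal_Max(2)
    by (intro gf_fsum) auto
  also have "(\<lambda>k. gf {xs \<in> pos_unimodal. Max (set xs) - 1 = k} sum_list)
      = (\<lambda>k. ?X ^ Suc k * (part_gf (Suc k) * part_gf k))"
  proof
    fix k
    have "{xs \<in> pos_unimodal. Max (set xs) - 1 = k} = {xs \<in> pos_unimodal. Max (set xs) = Suc k
        \<and> 1 \<le> count_list xs (Suc k) \<and> (Suc k < Suc k \<longrightarrow> count_list xs (Suc k) = 1)}"
      using pos_unimodal_Max(1,3) by (force simp: Suc_le_eq)
    also have "gf \<dots> sum_list = ?X ^ (1 * Suc k) * (part_gf (Suc k) * part_gf (Suc k - 1))"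
      by (intro gf_unimodal_Max) auto
    finally show "gf {xs \<in> pos_unimodal. Max (set xs) - 1 = k} sum_list
        = ?X ^ Suc k * (part_gf (Suc k) * part_gf k)"
      by (simp only: mult_1 diff_Suc_1)
  qed
  finally have "gf pos_unimodal sum_list $ n
      = (\<Sum>k\<le>n. ?X ^ Suc k * (part_gf (Suc k) * part_gf k)) $ n"
    by (simp add: fsum_def fps_sum_nth)
  also have "(\<Sum>k\<le>n. ?X ^ Suc k * (part_gf (Suc k) * part_gf k))
      = (\<Sum>k\<le>n. ?X ^ Suc k * (part_gf (Suc k) * ((1 - ?X ^ Suc k) * part_gf (Suc k))))"
    by (simp only: part_gf_Suc)
  also have "\<dots> = (\<Sum>k\<le>Suc n. ?X ^ k * (part_gf k * ((1 - ?X ^ k) * part_gf k)))"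
    unfolding sum.atMost_Suc_shift by simp
  also have "\<dots>
      = (\<Sum>k\<le>Suc n. ?X ^ (1 * k) * (part_gf k)\<^sup>2) - (\<Sum>k\<le>Suc n. ?X ^ (2 * k) * (part_gf k)\<^sup>2)"
    unfolding sum_subtractf[symmetric] mult_2 power_add
    by (simp add: right_diff_distrib left_diff_distrib power2_eq_square mult_ac)
  also have "\<dots> $ n = (unimodal_gf 1 - unimodal_gf 2) $ n"
    unfolding unimodal_gf_def fps_sub_nth
    by (subst (1 2) fsum_nth_ge[of _ n "Suc n"])
        (auto simp: fps_sum_nth intro!: locfin_X_power_mult)
  finally show "gf pos_unimodal sum_list $ n = (unimodal_gf 1 - unimodal_gf 2) $ n" .
qed

lemma unimodal_count_pos:
  assumes "0 < m"
  shows "int (unimodal_count m (int n)) = unimodal_gf m $ n"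
proof -
  have "{xs \<in> unimodal_compositions (n + m). count_list xs (Max (set xs)) = m}
      = {xs \<in> {xs \<in> pos_unimodal. count_list xs (Max (set xs)) = m}. sum_list xs = n + m}"
    by (auto simp: unimodal_compositions_eq)
  then have "int (unimodal_count m (int n))
      = gf {xs \<in> pos_unimodal. count_list xs (Max (set xs)) = m} sum_list $ (n + m)"
    using assms by (simp add: unimodal_count_def gf_nth)
  then show ?thesis by (simp add: gf_unimodal_count_Max[OF assms] fps_X_power_mult_nth)
qed

text \<open>The conventional value 0 at n = 0 fits because U_1 and U_2 both have constant term
  1.\<close>

lemma unimodal_count_0: "int (unimodal_count 0 (int n)) = (unimodal_gf 1 - unimodal_gf 2) $ n"
proof (cases "n = 0")
  case True
  then show ?thesis by (simp add: unimodal_count_def unimodal_gf_def fsum_def)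
next
  case False
  then show ?thesis
    unfolding gf_pos_unimodal[symmetric]
        by (simp add: unimodal_count_def unimodal_compositions_eq gf_nth)
qed

section \<open>The crank\<close>

lemma filter_mset_none: "(\<And>x. x \<in># p \<Longrightarrow> \<not> P x) \<Longrightarrow> filter_mset P p = {#}"
  by (induction p) auto

lemma filter_mset_id: "(\<And>x. x \<in># p \<Longrightarrow> P x) \<Longrightarrow> filter_mset P p = p"
  by (induction p) auto

text \<open>For w > 0 every member has crank j - w.\<close>

definition crank_parts :: "nat \<Rightarrow> nat \<Rightarrow> nat multiset set" where
  "crank_parts w j = {p. 0 \<notin># p \<and> count p 1 = w \<and> size (filter_mset (\<lambda>x. w < x) p) = j}"

text \<open>Besides the \<open>w\<close> ones there are parts from 2 to \<open>w\<close>, counted by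
  (1 - q)/(q)_w, and \<open>j\<close> parts above \<open>w\<close>. Lowering the latter by w + 1
  leaves an arbitrary multiset of size \<open>j\<close>.\<close>

lemma gf_crank_parts:
  assumes w: "0 < w"
  shows "gf (crank_parts w j) sum_mset
      = fps_X ^ (w + Suc w * j) * ((1 - fps_X) * (part_gf w * part_gf j))"
proof -
  define f :: "nat multiset \<times> nat multiset \<Rightarrow> nat multiset" where
    "f = (\<lambda>(a, b). replicate_mset w 1 + a + image_mset (\<lambda>x. x + Suc w) b)"
  define g :: "nat multiset \<Rightarrow> nat multiset \<times> nat multiset" where
    "g p = (filter_mset (\<lambda>x. 1 < x \<and> x \<le> w) p, image_mset (\<lambda>x. x - Suc w)
        (filter_mset (\<lambda>x. w < x) p))" for p
  have bij: "bij_betw f (msets {2..w} \<times> msets_size j) (crank_parts w j)"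
  proof (rule bij_betwI[of _ _ _ g])
    have *: "f ab \<in> crank_parts w j \<and> g (f ab) = ab"
        if mem: "ab \<in> msets {2..w} \<times> msets_size j" for ab
    proof -
      obtain a b where ab: "ab = (a, b)" "set_mset a \<subseteq> {2..w}" "size b = j"
        using mem by (cases ab) (auto simp: msets_def msets_size_def)
      have a: "\<And>x. x \<in># a \<Longrightarrow> 2 \<le> x \<and> x \<le> w" using ab(2) by auto
      let ?b = "image_mset (\<lambda>x. x + Suc w) b"
      have fab: "f ab = replicate_mset w 1 + a + ?b" by (simp only: f_def ab prod.case)
      have "filter_mset (\<lambda>x. 1 < x \<and> x \<le> w) (replicate_mset w 1) = {#}"
        "filter_mset (\<lambda>x. w < x) (replicate_mset w 1) = {#}"
        "filter_mset (\<lambda>x. 1 < x \<and> x \<le> w) a = a"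
        "filter_mset (\<lambda>x. w < x) a = {#}"
        "filter_mset (\<lambda>x. 1 < x \<and> x \<le> w) ?b = {#}"
        "filter_mset (\<lambda>x. w < x) ?b = ?b"
        using w by (auto intro!: filter_mset_none filter_mset_id split: if_splits dest: a)
      then have filter: "filter_mset (\<lambda>x. 1 < x \<and> x \<le> w) (f ab) = a"
        "filter_mset (\<lambda>x. w < x) (f ab) = ?b"
        unfolding fab filter_union_mset by (simp_all only: add_0 add_0_right)
      have "g (f ab) = ab"
        unfolding g_def filter multiset.map_comp comp_def add_diff_cancel_right'
            by (simp add: ab(1))
      moreover have "count a 1 = 0" "count ?b 1 = 0"
        using w by (auto simp: not_in_iff[symmetric] dest: a)
      then have "count (f ab) 1 = w" unfolding fab by simp
      moreover have "0 \<notin># f ab" using a[of 0] by (auto simp: fab in_replicate_mset)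
      ultimately show ?thesis by (simp add: crank_parts_def filter ab(3) del: One_nat_def)
    qed
    then show "f \<in> msets {2..w} \<times> msets_size j \<rightarrow> crank_parts w j"
      "\<And>ab. ab \<in> msets {2..w} \<times> msets_size j \<Longrightarrow> g (f ab) = ab" by blast+
    show "g \<in> crank_parts w j \<rightarrow> msets {2..w} \<times> msets_size j"
      by (auto simp: g_def crank_parts_def msets_def msets_size_def)
    show "f (g p) = p" if "p \<in> crank_parts w j" for p
    proof -
      have "image_mset (\<lambda>x. x + Suc w) (image_mset (\<lambda>x. x - Suc w) (filter_mset (\<lambda>x. w < x) p))
          = image_mset (\<lambda>x. x) (filter_mset (\<lambda>x. w < x) p)"
        unfolding multiset.map_comp by (intro image_mset_cong) auto
      moreover have "replicate_mset w 1 + filter_mset (\<lambda>x. 1 < x \<and> x \<le> w) p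
          + filter_mset (\<lambda>x. w < x) p = p"
      proof (rule multiset_eqI)
        fix x
        have "count p 0 = 0" "count p 1 = w" using that by (auto simp: crank_parts_def not_in_iff)
        then show "count (replicate_mset w 1 + filter_mset (\<lambda>x. 1 < x \<and> x \<le> w) p
            + filter_mset (\<lambda>x. w < x) p) x = count p x"
          using w by (cases "x = 0"; cases "x = 1") auto
      qed
      ultimately show ?thesis by (simp add: f_def g_def)
    qed
  qed
  have "gf (crank_parts w j) sum_mset
      = fps_X ^ (w + Suc w * j)
          * gf (msets {2..w} \<times> msets_size j) (\<lambda>(a, b). sum_mset a + sum_mset b)"
    using bij by (rule gf_reindex)
        (auto simp: f_def sum_mset_image_add msets_size_def simp del: add_Suc_right)
  then show ?thesis
    using w by (simp
        add: gf_Times finfib_msets finfib_msets_size gf_msets_from_2 gf_msets_size mult.assoc)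
qed

lemma int_partitions_eq: "int_partitions n = {p \<in> {p. 0 \<notin># p}. sum_mset p = n}"
  by (auto simp: int_partitions_def)

lemma finite_int_partitions: "finite (int_partitions n)"
  using finfib_pos by (simp add: int_partitions_eq finfib_def)

lemma msets_pos: "msets {1..} = {p :: nat multiset. 0 \<notin># p}"
  by (auto simp: msets_def Suc_le_eq) (metis gr0I)

text \<open>Partitions into \<open>k\<close> parts become arbitrary multisets of size
  \<open>k\<close> when every part is lowered by one.\<close>

lemma gf_pos: "gf {p. 0 \<notin># p} sum_mset = euler_sum 1"
proof -
  have "gf {p. 0 \<notin># p} sum_mset = fsum (\<lambda>k. gf {p \<in> {p. 0 \<notin># p}. size p = k} sum_mset)"
    using finfib_pos by (intro gf_fsum) (auto intro: size_le_sum_mset)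
  also have "(\<lambda>k. gf {p \<in> {p. 0 \<notin># p}. size p = k} sum_mset) = (\<lambda>k. fps_X ^ (1 * k) * part_gf k)"
  proof
    fix k
    have "bij_betw (image_mset (\<lambda>x. x + 1)) (msets_size k) {p \<in> {p. (0::nat) \<notin># p}. size p = k}"
    proof (rule bij_betwI[of _ _ _ "image_mset (\<lambda>x. x - 1)"])
      show "image_mset (\<lambda>x. x + 1) (image_mset (\<lambda>x. x - 1) p) = p"
          if "p \<in> {p \<in> {p. 0 \<notin># p}. size p = k}" for p :: "nat multiset"
      proof -
        have "image_mset (\<lambda>x. x + 1) (image_mset (\<lambda>x. x - 1) p) = image_mset (\<lambda>x. x) p"
          unfolding multiset.map_comp
        proof (rule image_mset_cong)
          fix x assume "x \<in># p"
          moreover have "0 \<notin># p" using that by simp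
          ultimately have "x \<noteq> 0" by metis
          then show "((\<lambda>x. x + 1) \<circ> (\<lambda>x. x - 1)) x = x" by simp
        qed
        then show ?thesis by simp
      qed
    qed (auto simp: msets_size_def multiset.map_comp comp_def)
    then have "gf {p \<in> {p. 0 \<notin># p}. size p = k} sum_mset
        = fps_X ^ (1 * k) * gf (msets_size k) sum_mset"
      by (rule gf_reindex)
          (auto simp: sum_mset_image_add msets_size_def simp del: Suc_eq_plus1 add_Suc_right)
    then show "gf {p \<in> {p. 0 \<notin># p}. size p = k} sum_mset = fps_X ^ (1 * k) * part_gf k"
      by (simp only: gf_msets_size)
  qed
  finally show ?thesis by (simp only: euler_sum_def)
qed

lemma gf_no_ones: "gf {p. 0 \<notin># p \<and> count p 1 = 0} sum_mset = (1 - fps_X) * euler_sum 1"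
proof -
  have "insert 1 {2..} = {1::nat..}" by auto
  moreover have "msets {2..} = {p :: nat multiset. 0 \<notin># p \<and> count p 1 = 0}"
  proof -
    have "{2..} = - {0, 1 :: nat}" by auto
    then show ?thesis by (auto simp: msets_def not_in_iff[symmetric])
  qed
  ultimately show ?thesis
    using gf_msets_insert[of 1 "{2..}"] by (simp only: msets_pos gf_pos power_one_right) simp
qed

lemma fsum_drop_0: "fsum (\<lambda>k. if k = 0 then 0 else f k) = fsum f - f 0"
proof (rule fps_ext)
  fix n
  have "fsum f $ n = (\<Sum>k\<le>n. (if k = 0 then 0 else f k) $ n + (if k = 0 then f 0 $ n else 0))"
    unfolding fsum_def fps_nth_Abs_fps by (intro sum.cong) auto
  then show "fsum (\<lambda>k. if k = 0 then 0 else f k) $ n = (fsum f - f 0) $ n"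
    by (simp add: fsum_def sum.distrib)
qed

lemma count_le_sum_mset: "0 \<notin># p \<Longrightarrow> count p x \<le> sum_mset (p :: nat multiset)"
  by (rule order_trans[OF count_le_size size_le_sum_mset])

text \<open>Here \<open>h w\<close> prescribes how many parts exceed \<open>w\<close> when there are
  \<open>w\<close> ones. The subtracted series is the closed form at w = 0, which counts nothing in
  \<open>S\<close>.\<close>

lemma gf_fsum_ones:
  assumes "\<And>w. 0 < w \<Longrightarrow> {p \<in> S. count p 1 = w} = crank_parts w (h w)"
    "\<And>p. p \<in> S \<Longrightarrow> 0 \<notin># p \<and> 0 < count p 1"
  shows "gf S sum_mset
      = fsum (\<lambda>w. fps_X ^ (w + Suc w * h w) * ((1 - fps_X) * (part_gf w * part_gf (h w))))
      - fps_X ^ h 0 * ((1 - fps_X) * part_gf (h 0))"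
proof -
  have "gf S sum_mset = fsum (\<lambda>w. gf {p \<in> S. count p 1 = w} sum_mset)"
    using assms(2) count_le_sum_mset by (intro gf_fsum finfib_subset[OF finfib_pos]) auto
  also have "(\<lambda>w. gf {p \<in> S. count p 1 = w} sum_mset)
      = (\<lambda>w.
          if w = 0 then 0 else fps_X ^ (w + Suc w * h w)
              * ((1 - fps_X) * (part_gf w * part_gf (h w))))"
  proof
    fix w
    show "gf {p \<in> S. count p 1 = w} sum_mset
      = (if w = 0 then 0 else fps_X ^ (w + Suc w * h w)
          * ((1 - fps_X) * (part_gf w * part_gf (h w))))"
    proof (cases "w = 0")
      case True
      then have e: "{p \<in> S. count p 1 = w} = {}" using assms(2) by auto
      show ?thesis unfolding e using True by (auto intro: fps_ext simp: gf_nth)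
    next
      case False
      then have "{p \<in> S. count p 1 = w} = crank_parts w (h w)" by (intro assms(1)) simp
      then show ?thesis using False by (simp only: gf_crank_parts) simp
    qed
  qed
  finally show ?thesis by (simp only: fsum_drop_0) simp
qed

definition big_parts :: "nat multiset \<Rightarrow> nat" where
  "big_parts p = size (filter_mset (\<lambda>x. count p 1 < x) p)"

lemma gf_balanced:
  "gf {p. 0 \<notin># p \<and> 0 < count p 1 \<and> big_parts p = count p 1} sum_mset
    = (1 - fps_X) * balanced_gf - (1 - fps_X)"
proof -
  let ?X = "fps_X :: int fps"
  have "gf {p. 0 \<notin># p \<and> 0 < count p 1 \<and> big_parts p = count p 1} sum_mset
    = fsum (\<lambda>w. ?X ^ (w + Suc w * w) * ((1 - ?X) * (part_gf w * part_gf w)))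
        - ?X ^ 0 * ((1 - ?X) * part_gf 0)"
    by (rule gf_fsum_ones) (auto simp: crank_parts_def big_parts_def)
  also have "(\<lambda>w. ?X ^ (w + Suc w * w) * ((1 - ?X) * (part_gf w * part_gf w)))
      = (\<lambda>w. (1 - ?X) * (?X ^ (w * w + 2 * w) * (part_gf w)\<^sup>2))"
  proof
    fix w
    have "w + Suc w * w = w * w + 2 * w" by simp
    then show "?X ^ (w + Suc w * w) * ((1 - ?X) * (part_gf w * part_gf w))
        = (1 - ?X) * (?X ^ (w * w + 2 * w) * (part_gf w)\<^sup>2)"
      by (simp only: power2_eq_square mult_ac)
  qed
  also have "fsum \<dots> = (1 - ?X) * balanced_gf"
    unfolding balanced_gf_def by (intro fsum_mult_left[symmetric] locfin_X_power_mult) auto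
  finally show ?thesis by simp
qed

text \<open>This is the edge j = 0. Compared with \<open>gf_no_ones\<close>, it shows that from
  degree 2 on these partitions are as numerous as those without ones.\<close>

lemma gf_no_big_parts:
  "gf {p. 0 \<notin># p \<and> 0 < count p 1 \<and> big_parts p = 0} sum_mset
      = (1 - fps_X) * euler_sum 1 - (1 - fps_X)"
proof -
  let ?X = "fps_X :: int fps"
  have "gf {p. 0 \<notin># p \<and> 0 < count p 1 \<and> big_parts p = 0} sum_mset
    = fsum (\<lambda>w. ?X ^ (w + Suc w * 0) * ((1 - ?X) * (part_gf w * part_gf 0)))
        - ?X ^ 0 * ((1 - ?X) * part_gf 0)"
    by (rule gf_fsum_ones) (auto simp: crank_parts_def big_parts_def)
  also have "(\<lambda>w. ?X ^ (w + Suc w * 0) * ((1 - ?X) * (part_gf w * part_gf 0)))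
      = (\<lambda>w. (1 - ?X) * (?X ^ (1 * w) * part_gf w))"
    by (simp add: mult_ac)
  also have "fsum \<dots> = (1 - ?X) * euler_sum 1"
    unfolding euler_sum_def by (intro fsum_mult_left[symmetric] locfin_X_power_mult) auto
  finally show ?thesis by simp
qed

lemma card_crank_parts_commute:
  assumes "0 < w" "0 < j"
  shows "card {p \<in> crank_parts w j. sum_mset p = n} = card {p \<in> crank_parts j w. sum_mset p = n}"
proof -
  have "w + Suc w * j = j + Suc j * w" by simp
  then have "gf (crank_parts w j) sum_mset = gf (crank_parts j w) sum_mset"
    unfolding gf_crank_parts[OF assms(1)] gf_crank_parts[OF assms(2)]
        by (simp only: mult.commute[of "part_gf w"])
  from arg_cong[OF this, of "\<lambda>f. f $ n"] show ?thesis by (simp add: gf_nth)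
qed

text \<open>The interior of the symmetry: exchanging two positive indices changes the sign of the
  crank.\<close>

lemma card_big_parts_swap:
  "card {p \<in> int_partitions n. 0 < count p 1 \<and> count p 1 < big_parts p}
    = card {p \<in> int_partitions n. 0 < big_parts p \<and> big_parts p < count p 1}"
proof -
  define I where "I = {(w, j). 0 < w \<and> w < j \<and> j \<le> n}"
  have fin: "finite I" by (rule finite_subset[of _ "{..n} \<times> {..n}"]) (auto simp: I_def)
  have fins: "finite {p \<in> crank_parts w j. sum_mset p = n}" for w j
    by (rule finite_subset[OF _ finite_int_partitions[of n]])
        (auto simp: crank_parts_def int_partitions_def)
  have bnd: "count p 1 \<le> n \<and> big_parts p \<le> n" if "p \<in> int_partitions n" for p
    using that count_le_sum_mset[of p 1]
        order_trans[OF size_filter_mset_lesseq size_le_sum_mset, of p]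
    by (auto simp: int_partitions_def big_parts_def)
  have "{p \<in> int_partitions n. 0 < count p 1 \<and> count p 1 < big_parts p}
      = (\<Union>(w, j)\<in>I. {p \<in> crank_parts w j. sum_mset p = n})"
    using bnd by (fastforce simp: I_def crank_parts_def int_partitions_def big_parts_def)
  then have "card {p \<in> int_partitions n. 0 < count p 1 \<and> count p 1 < big_parts p}
      = card (\<Union>x\<in>I. case x of (w, j) \<Rightarrow> {p \<in> crank_parts w j. sum_mset p = n})" by simp
  also have "\<dots> = (\<Sum>x\<in>I. card (case x of (w, j) \<Rightarrow> {p \<in> crank_parts w j. sum_mset p = n}))"
    using fin fins by (intro card_UN_disjoint) (auto simp: crank_parts_def)
  also have "\<dots> = (\<Sum>x\<in>I. card (case x of (w, j) \<Rightarrow> {p \<in> crank_parts j w. sum_mset p = n}))"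
    by (intro sum.cong) (auto simp: I_def intro: card_crank_parts_commute)
  also have "\<dots> = card (\<Union>x\<in>I. case x of (w, j) \<Rightarrow> {p \<in> crank_parts j w. sum_mset p = n})"
    using fin fins by (intro card_UN_disjoint[symmetric]) (auto simp: crank_parts_def)
  also have "(\<Union>x\<in>I. case x of (w, j) \<Rightarrow> {p \<in> crank_parts j w. sum_mset p = n})
      = {p \<in> int_partitions n. 0 < big_parts p \<and> big_parts p < count p 1}"
    using bnd by (fastforce simp: I_def crank_parts_def int_partitions_def big_parts_def)
  finally show ?thesis .
qed

section \<open>Counting partitions by the sign of the crank\<close>

lemma crank_eq:
  "crank p = (if count p 1 = 0 then int (Max_mset p) else int (big_parts p) - int (count p 1))"
  by (simp add: crank_def big_parts_def Let_def del: count_greater_zero_iff)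

lemma Max_mset_pos:
  assumes "p \<in> int_partitions n" "0 < n"
  shows "0 < Max_mset p"
proof -
  have "p \<noteq> {#}" using assms by (auto simp: int_partitions_def)
  then have "Max_mset p \<in># p" by simp
  then show ?thesis using assms by (auto simp: int_partitions_def intro: gr0I)
qed

text \<open>For n >= 2, crank 0 forces a part 1, since otherwise the crank is the positive largest
  part. At n = 1 the conventional -1 is the coefficient contributed by the term w = 0 of
  \<open>balanced_gf\<close>.\<close>

lemma crank_count_2:
  assumes "n \<ge> 1"
  shows "crank_count 2 n = ((1 - fps_X) * balanced_gf) $ n"
proof (cases "n = 1")
  case True
  have "fsum (\<lambda>w. fps_X ^ (w * w + 2 * w) * (part_gf w)\<^sup>2) $ i = (if i = 0 then 1 else 0)"
      if "i \<le> 1" for i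
    using that by (cases i) (auto simp: fsum_def fps_X_power_mult_nth)
  then show ?thesis using True
    by (simp add: crank_count_def balanced_gf_def left_diff_distrib fps_X_mult_nth)
next
  case False
  have "{p \<in> int_partitions n. crank p = 0}
      = {p \<in> {p. 0 \<notin># p \<and> 0 < count p 1 \<and> big_parts p = count p 1}. sum_mset p = n}"
  proof (rule set_eqI)
    fix p
    show "p \<in> {p \<in> int_partitions n. crank p = 0}
        \<longleftrightarrow> p \<in> {p \<in> {p. 0 \<notin># p \<and> 0 < count p 1 \<and> big_parts p = count p 1}. sum_mset p = n}"
      using Max_mset_pos[of p n, unfolded int_partitions_def] assms
      by (cases "p \<in> int_partitions n"; cases "count p 1 = 0")
          (auto simp: crank_eq int_partitions_def simp del: count_greater_zero_iff)
  qed
  then have "crank_count 2 n = ((1 - fps_X) * balanced_gf - (1 - fps_X)) $ n"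
    using False unfolding gf_balanced[symmetric] gf_nth by (simp only: crank_count_def) simp
  then show ?thesis using False assms by simp
qed

text \<open>At n = 1 the conventions give 0 = 1 + (-1).\<close>

lemma crank_count_1_eq:
  assumes "n \<ge> 1"
  shows "crank_count 1 n = crank_count 0 n + crank_count 2 n"
proof -
  have "{p \<in> int_partitions n. 0 \<le> crank p}
      = {p \<in> int_partitions n. 0 < crank p} \<union> {p \<in> int_partitions n. crank p = 0}"
    by auto
  also have "card \<dots>
      = card {p \<in> int_partitions n. 0 < crank p} + card {p \<in> int_partitions n. crank p = 0}"
    using finite_int_partitions by (intro card_Un_disjoint) auto
  finally show ?thesis by (simp add: crank_count_def)
qed

lemma card_int_partitions: "int (card (int_partitions n)) = euler_sum 1 $ n"
  by (simp only: int_partitions_eq flip: gf_nth gf_pos)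

text \<open>The edge w = 0 balances the edge j = 0, and the interior balances itself. At n = 1 this
  fails: the only partition has crank -1.\<close>

lemma card_crank_symmetric:
  assumes "n \<ge> 2"
  shows "card {p \<in> int_partitions n. 0 < crank p} = card {p \<in> int_partitions n. crank p < 0}"
proof -
  let ?P = "int_partitions n"
  have "{p \<in> ?P. 0 < crank p}
      = {p \<in> ?P. count p 1 = 0} \<union> {p \<in> ?P. 0 < count p 1 \<and> count p 1 < big_parts p}"
    using Max_mset_pos[of _ n] assms
        by (auto simp: crank_eq simp del: count_greater_zero_iff split: if_splits)
  then have 1: "card {p \<in> ?P. 0 < crank p}
      = card {p \<in> ?P. count p 1 = 0} + card {p \<in> ?P. 0 < count p 1 \<and> count p 1 < big_parts p}"
    using finite_int_partitions
        by (simp add: card_Un_disjoint disjoint_iff del: count_greater_zero_iff)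
  have "{p \<in> ?P. crank p < 0}
      = {p \<in> ?P. 0 < count p 1 \<and> big_parts p = 0}
          \<union> {p \<in> ?P. 0 < big_parts p \<and> big_parts p < count p 1}"
    by (auto simp: crank_eq simp del: count_greater_zero_iff split: if_splits)
  then have 2: "card {p \<in> ?P. crank p < 0}
      = card {p \<in> ?P. 0 < count p 1 \<and> big_parts p = 0}
          + card {p \<in> ?P. 0 < big_parts p \<and> big_parts p < count p 1}"
    using finite_int_partitions
        by (simp add: card_Un_disjoint disjoint_iff del: count_greater_zero_iff)
  have "{p \<in> ?P. count p 1 = 0} = {p \<in> {p. 0 \<notin># p \<and> count p 1 = 0}. sum_mset p = n}"
    "{p \<in> ?P. 0 < count p 1 \<and> big_parts p = 0}
        = {p \<in> {p. 0 \<notin># p \<and> 0 < count p 1 \<and> big_parts p = 0}. sum_mset p = n}"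
    by (auto simp: int_partitions_def)
  then have "int (card {p \<in> ?P. count p 1 = 0}) = ((1 - fps_X) * euler_sum 1) $ n"
    "int (card {p \<in> ?P. 0 < count p 1 \<and> big_parts p = 0})
        = ((1 - fps_X) * euler_sum 1 - (1 - fps_X)) $ n"
    unfolding gf_no_big_parts[symmetric] unfolding gf_no_ones[symmetric] gf_nth by simp_all
  then have "card {p \<in> ?P. count p 1 = 0} = card {p \<in> ?P. 0 < count p 1 \<and> big_parts p = 0}"
    using assms by simp
  then show ?thesis by (simp only: 1 2 card_big_parts_swap)
qed

text \<open>By symmetry C_0 also counts the negative cranks, which complement C_1. At n = 1 the
  conventional values 1 and 0 add up to the one partition.\<close>

lemma crank_count_0_plus_1:
  assumes "n \<ge> 1"
  shows "crank_count 0 n + crank_count 1 n = euler_sum 1 $ n"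
proof (cases "n = 1")
  case True
  have "part_gf 1 $ 0 = 1" using arg_cong[OF part_gf_Suc[of 0], of "\<lambda>f. f $ 0"]
      by (simp add: left_diff_distrib)
  then have "euler_sum 1 $ 1 = 1" by (simp add: euler_sum_def fsum_def fps_X_mult_nth)
  then show ?thesis using True by (simp add: crank_count_def)
next
  case False
  have "int_partitions n
      = {p \<in> int_partitions n. crank p < 0} \<union> {p \<in> int_partitions n. 0 \<le> crank p}"
    by auto
  then have "card (int_partitions n)
      = card {p \<in> int_partitions n. crank p < 0} + card {p \<in> int_partitions n. 0 \<le> crank p}"
    using finite_int_partitions by (subst card_Un_disjoint[symmetric]) auto
  then show ?thesis
    using False assms card_crank_symmetric[of n] card_int_partitions[of n]
        by (simp add: crank_count_def)
qed

text \<open>No two summands of the pentagonal sum evaluate \<^const>\<open>unimodal_count\<close> at the same point.\<close>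
lemma pent_eq_iff: "pent j = pent k \<longleftrightarrow> j = k"
proof
  have double: "2 * pent i = i * (3 * i - 1)" for i
  proof -
    have "even (i * (3 * i - 1))" by simp
    then show ?thesis by (simp add: pent_def)
  qed
  assume "pent j = pent k"
  then have "j * (3 * j - 1) = k * (3 * k - 1)" by (simp flip: double)
  then have "j = k \<or> 3 * (j + k) = 1" by algebra
  moreover have "3 * (j + k) \<noteq> 1" by presburger
  ultimately show "j = k" by blast
qed simp

text \<open>The factor \<open>c\<close> is 2 for m = 0 and m = 1, where the series identities are
  doubled; this avoids halving \<open>V\<close>.\<close>

lemma pentagonal_unimodal_sum:
  assumes "\<And>i. c * int (unimodal_count m (int i)) = (euler_sum 1 * V) $ i"
  shows "c * Sum_any
      (\<lambda>j::int. (- 1) ^ nat \<bar>j\<bar> * int (unimodal_count m (int n - j * (3 * j - 1) div 2)))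
    = V $ n"
proof -
  have "c * Sum_any
      (\<lambda>j::int. (- 1) ^ nat \<bar>j\<bar> * int (unimodal_count m (int n - j * (3 * j - 1) div 2)))
      = Sum_any (\<lambda>j::int. (- 1) ^ nat \<bar>j\<bar> * (c * int (unimodal_count m (int n - pent j))))"
    using finite_support_pentagonal_sum[of m n]
    by (simp add: Sum_any_right_distrib pent_def mult.left_commute)
  also have "\<dots> = V $ n"
  proof (rule pentagonal_sum_eq)
    show "c * int (unimodal_count m i) = 0" if "i < 0" for i
      using that by (simp add: unimodal_count_def)
    show "c * int (unimodal_count m i) = (euler_sum 1 * V) $ nat i" if "0 \<le> i" for i
      using assms[of "nat i"] that by simp
  qed
  finally show ?thesis .
qed

theorem corollary1p6:
  fixes n m :: nat
  assumes "n \<ge> 1" and "m \<in> {0, 1, 2}"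
  shows "crank_count m n =
    Sum_any (\<lambda>j::int. (- 1) ^ nat \<bar>j\<bar> * int (unimodal_count m (int n - j * (3 * j - 1) div 2)))"
proof -
  let ?S = "\<lambda>m. Sum_any
      (\<lambda>j::int. (- 1) ^ nat \<bar>j\<bar> * int (unimodal_count m (int n - j * (3 * j - 1) div 2)))"
  let ?G = "(1 - fps_X) * balanced_gf"
  have U1: "2 * unimodal_gf 1 = euler_sum 1 * (euler_sum 1 + ?G)"
    using unimodal_gf_1 unimodal_gf_2 by (simp add: power2_eq_square distrib_left diff_eq_eq)
  have "1 * int (unimodal_count 2 (int i)) = (euler_sum 1 * ?G) $ i" for i
    unfolding unimodal_gf_2[symmetric] by (simp add: unimodal_count_pos)
  from pentagonal_unimodal_sum[OF this] have S2: "?S 2 = ?G $ n" by simp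
  have "2 * int (unimodal_count 1 (int i)) = (euler_sum 1 * (euler_sum 1 + ?G)) $ i" for i
    unfolding U1[symmetric] by (simp only: mult_2 fps_add_nth unimodal_count_pos[OF zero_less_one])
  from pentagonal_unimodal_sum[OF this] have S1: "2 * ?S 1 = euler_sum 1 $ n + ?G $ n" by simp
  have "2 * int (unimodal_count 0 (int i)) = (euler_sum 1 * (euler_sum 1 - ?G)) $ i" for i
  proof -
    have "euler_sum 1 * (euler_sum 1 - ?G) = 2 * (unimodal_gf 1 - unimodal_gf 2)"
      using U1 by (simp add: unimodal_gf_2 algebra_simps)
    then show ?thesis by (simp only: mult_2 fps_add_nth unimodal_count_0)
  qed
  from pentagonal_unimodal_sum[OF this] have S0: "2 * ?S 0 = euler_sum 1 $ n - ?G $ n" by simp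
  \<comment> \<open>Writing E and G for the coefficients of \<open>euler_sum 1\<close> and
    \<open>?G\<close>, the crank counts satisfy C_2 = G, C_1 - C_0 = G and C_0 + C_1 = E, so 2 C_0 =
    E - G and 2 C_1 = E + G.\<close>
  have "crank_count 0 n = ?S 0" "crank_count 1 n = ?S 1" "crank_count 2 n = ?S 2"
    using S0 S1 S2 crank_count_2[OF assms(1)] crank_count_1_eq[OF assms(1)]
        crank_count_0_plus_1[OF assms(1)]
    by linarith+
  then show ?thesis using assms(2) by (elim insertE emptyE) (simp_all only:)
qed

end
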